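(* For every real $k$ with $|k|\ge 16/(3\sqrt3)$, we have $\mathrm{m}(P_k)=\mathrm{m}(R_k)$, where $$P_k(x,y)=(x^2+x+1)y^2+kx(x+1)y+x(x^2+x+1)\qquad\text{and}\qquad R_k(x,y)=y^3-y+x^3-x+kxy.$$
   Context: For a nonzero Laurent polynomial $F(x,y)\in\mathbb C[x^{\pm1},y^{\pm1}]$, its (logarithmic) Mahler measure is $$\mathrm{m}(F)=\frac1{(2\pi i)^2}\iint_{|x|=|y|=1}\log|F(x,y)|\,\frac{dx}{x}\,\frac{dy}{y}.$$ *)

theory Defs
  imports "HOL-Analysis.Analysis"
begin

text \<open>Logarithmic Mahler measure of a two-variable Laurent polynomial F, given as a
function on (nonzero) complex pairs:
  m(F) = 1/(2 pi)^2 * integral over [0,2pi]^2 of log |F(e^{i s}, e^{i t})| ds dt.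
(Note: Isabelle's ln 0 = 0, but the zero set of a nonzero Laurent polynomial
on the torus has measure zero, so this does not matter.)\<close>

definition mahler_measure2 :: "(complex \<Rightarrow> complex \<Rightarrow> complex) \<Rightarrow> real" where
  "mahler_measure2 F =
     (1 / (2 * pi)^2) *
     (LINT p : {0..2*pi} \<times> {0..2*pi} | lborel.
        ln (cmod (F (cis (fst p)) (cis (snd p)))))"

definition P_poly :: "real \<Rightarrow> complex \<Rightarrow> complex \<Rightarrow> complex" where
  "P_poly k x y = (x^2 + x + 1) * y^2 + of_real k * x * (x + 1) * y + x * (x^2 + x + 1)"

definition R_poly :: "real \<Rightarrow> complex \<Rightarrow> complex \<Rightarrow> complex" where
  "R_poly k x y = y^3 - y + x^3 - x + of_real k * x * y"

end

theory Submission
  imports Defs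
begin

text \<open>
  Jensen's formula in one variable turns both Mahler measures into integrals over a circle; for \<open>R\<close>
  one first substitutes \<open>y = x w\<close>, which leaves a quadratic polynomial in \<open>x\<close>. The derivatives
  with respect to \<open>k\<close> of the two integrals are periods of elliptic curves, and these curves are
  2-isogenous, so the derivatives agree for \<open>k > 3\<close>. Both measures are \<open>ln k + o(1)\<close> as \<open>k\<close> tends to
  infinity, hence they coincide. The singular derivative for \<open>P\<close> is handled by writing increments
  in \<open>k\<close> as integrals of nonnegative functions and using Tonelli's theorem.
\<close>

section \<open>The circle measure and Jensen's formula\<close>

text \<open>Two thresholds on \<open>k\<close> with different origins are at work. The bound 16 / (3
  sqrt 3) enters through Jensen's formula for \<open>R\<close>, where both roots of the quadratic in
  \<open>x\<close> must stay on their own sides of the unit circle. The equality of the derivatives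
  holds on the larger range k > 3, where \<open>R_disc\<close> is positive, so the whole path from
  \<open>|k|\<close> to infinity is available. The sign of \<open>k\<close> disappears once the
  inner integrals are evaluated. The isogeny is used as a real change of variable between angles,
  with no theory of elliptic curves. Its angle map rises and then falls back, so it covers an
  interval twice; this matches the fact that the derivative for \<open>P\<close> lives on only part
  of the circle. The common asymptotics come from the terms multiplied by \<open>k\<close>, namely x
  (x + 1) y and x y: after the factor \<open>k\<close> is removed, what remains in the limit is the
  Mahler measure of 1 + x in one case and of 1 in the other, and both are 0.\<close>

definition circ :: "real measure" where
  "circ = density lborel (indicator {0..2*pi})"

lemma space_circ [simp]: "space circ = UNIV"
  by (simp add: circ_def)

lemma sets_circ [measurable_cong, simp]: "sets circ = sets borel"
  by (simp add: circ_def)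

lemma nn_integral_circ:
  assumes "f \<in> borel_measurable borel"
  shows "(\<integral>\<^sup>+t. f t \<partial>circ) = (\<integral>\<^sup>+t. f t * indicator {0..2*pi} t \<partial>lborel)"
  using assms unfolding circ_def by (subst nn_integral_density) (auto simp: mult.commute)

lemma emeasure_circ_UNIV: "emeasure circ UNIV = ennreal (2*pi)"
  by (simp add: circ_def emeasure_density)

lemma finite_measure_circ: "finite_measure circ"
  by (rule finite_measureI) (simp add: emeasure_circ_UNIV)

interpretation circ: finite_measure circ
  by (rule finite_measure_circ)

interpretation circ2: pair_sigma_finite circ circ ..

interpretation circ_lborel: pair_sigma_finite circ lborel ..

lemma measure_circ_UNIV: "measure circ UNIV = 2*pi"
  by (simp add: measure_def emeasure_circ_UNIV)

lemma integral_circ_const: "(\<integral>t. c \<partial>circ) = 2*pi*(c::real)"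
  by (simp add: measure_circ_UNIV)

lemma AE_circ_countable:
  assumes "countable A"
  shows "AE t in circ. t \<notin> A"
proof -
  have "AE t in lborel. t \<notin> A"
    using AE_not_in[OF countable_imp_null_set_lborel[OF assms]] .
  then show ?thesis
    unfolding circ_def by (subst AE_density) auto
qed

section \<open>Measure-preserving maps of the circle\<close>

lemma nn_integral_split_Icc:
  fixes f :: "real \<Rightarrow> ennreal"
  assumes "a \<le> b" "b \<le> c" and [measurable]: "f \<in> borel_measurable borel"
  shows "(\<integral>\<^sup>+t. f t * indicator {a..c} t \<partial>lborel) =
    (\<integral>\<^sup>+t. f t * indicator {a..b} t \<partial>lborel) + (\<integral>\<^sup>+t. f t * indicator {b..c} t \<partial>lborel)"
proof -
  have "(\<integral>\<^sup>+t. f t * indicator {a..c} t \<partial>lborel) =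
    (\<integral>\<^sup>+t. f t * indicator {a..b} t + f t * indicator {b..c} t \<partial>lborel)"
    using assms(1,2)
    by (intro nn_integral_cong_AE AE_I[of _ _ "{b}"]) (auto simp: indicator_def)
  also have "\<dots> = (\<integral>\<^sup>+t. f t * indicator {a..b} t \<partial>lborel) + (\<integral>\<^sup>+t. f t * indicator {b..c} t \<partial>lborel)"
    by (rule nn_integral_add) auto
  finally show ?thesis .
qed

lemma nn_integral_translate_Icc:
  fixes f :: "real \<Rightarrow> ennreal"
  assumes [measurable]: "f \<in> borel_measurable borel"
  shows "(\<integral>\<^sup>+t. f (t + s) * indicator {a..b} t \<partial>lborel) =
    (\<integral>\<^sup>+t. f t * indicator {a+s..b+s} t \<partial>lborel)"
  by (subst nn_integral_real_affine[of "\<lambda>t. f t * indicator {a+s..b+s} t" 1 s])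
     (auto simp: add.commute indicator_def intro!: nn_integral_cong)

text \<open>Only periodic integrands are tested, so that maps leaving the interval from 0 to 2 pi,
  such as shifts and doubling, count as measure preserving on the circle.\<close>

definition circle_map :: "(real \<Rightarrow> real) \<Rightarrow> bool" where
  "circle_map h \<longleftrightarrow> h \<in> borel_measurable borel \<and>
     (\<forall>f \<in> borel_measurable borel. (\<forall>t. f (t + 2*pi) = f t) \<longrightarrow>
        (\<integral>\<^sup>+t. f (h t) \<partial>circ) = (\<integral>\<^sup>+t. (f t :: ennreal) \<partial>circ))"

lemma circle_map_shift:
  assumes "0 \<le> a" "a \<le> 2*pi"
  shows "circle_map (\<lambda>t. t + a)"
  unfolding circle_map_def
proof (intro conjI ballI impI)
  fix f :: "real \<Rightarrow> ennreal"
  assume [measurable]: "f \<in> borel_measurable borel" and per: "\<forall>t. f (t + 2*pi) = f t"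
  have "(\<integral>\<^sup>+t. f (t + a) \<partial>circ) = (\<integral>\<^sup>+t. f t * indicator {a..2*pi+a} t \<partial>lborel)"
    using nn_integral_translate_Icc[of f a 0 "2*pi"] by (simp add: nn_integral_circ)
  also have "\<dots> = (\<integral>\<^sup>+t. f t * indicator {a..2*pi} t \<partial>lborel)
      + (\<integral>\<^sup>+t. f t * indicator {2*pi..2*pi+a} t \<partial>lborel)"
    using assms by (intro nn_integral_split_Icc) auto
  also have "(\<integral>\<^sup>+t. f t * indicator {2*pi..2*pi+a} t \<partial>lborel) = (\<integral>\<^sup>+t. f t * indicator {0..a} t \<partial>lborel)"
    using nn_integral_translate_Icc[of f "2*pi" 0 a] per by (simp add: add.commute)
  also have "(\<integral>\<^sup>+t. f t * indicator {a..2*pi} t \<partial>lborel) + (\<integral>\<^sup>+t. f t * indicator {0..a} t \<partial>lborel)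
      = (\<integral>\<^sup>+t. f t \<partial>circ)"
    using assms by (subst add.commute, subst nn_integral_split_Icc[symmetric]) (auto simp: nn_integral_circ)
  finally show "(\<integral>\<^sup>+t. f (t + a) \<partial>circ) = (\<integral>\<^sup>+t. f t \<partial>circ)" .
qed auto

text \<open>Doubling stretches the interval over two periods, and the Jacobian 1/2 compensates for
  the two equal copies.\<close>

lemma circle_map_double: "circle_map (\<lambda>t. 2 * t)"
  unfolding circle_map_def
proof (intro conjI ballI impI)
  fix f :: "real \<Rightarrow> ennreal"
  assume [measurable]: "f \<in> borel_measurable borel" and per: "\<forall>t. f (t + 2*pi) = f t"
  have "2 * (\<integral>\<^sup>+t. f (2 * t) \<partial>circ) = 2 * (\<integral>\<^sup>+t. f (2 * t) * indicator {0..4*pi} (2 * t) \<partial>lborel)"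
    by (simp add: nn_integral_circ indicator_def)
  also have "\<dots> = (\<integral>\<^sup>+t. f t * indicator {0..4*pi} t \<partial>lborel)"
    by (subst nn_integral_real_affine[of "\<lambda>t. f t * indicator {0..4*pi} t" 2 0]) auto
  also have "\<dots> = (\<integral>\<^sup>+t. f t * indicator {0..2*pi} t \<partial>lborel) + (\<integral>\<^sup>+t. f t * indicator {2*pi..4*pi} t \<partial>lborel)"
    by (rule nn_integral_split_Icc) auto
  also have "(\<integral>\<^sup>+t. f t * indicator {2*pi..4*pi} t \<partial>lborel) = (\<integral>\<^sup>+t. f t * indicator {0..2*pi} t \<partial>lborel)"
    using nn_integral_translate_Icc[of f "2*pi" 0 "2*pi"] per by simp
  finally have "2 * (\<integral>\<^sup>+t. f (2 * t) \<partial>circ) = 2 * (\<integral>\<^sup>+t. f t \<partial>circ)"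
    unfolding nn_integral_circ[OF \<open>f \<in> borel_measurable borel\<close>] by (subst (2) mult_2)
  then show "(\<integral>\<^sup>+t. f (2 * t) \<partial>circ) = (\<integral>\<^sup>+t. f t \<partial>circ)"
    by (simp add: ennreal_mult_cancel_left)
qed auto

lemma circle_map_nn_integral:
  fixes f :: "real \<Rightarrow> ennreal"
  assumes "circle_map h" "f \<in> borel_measurable borel" "\<And>t. f (t + 2*pi) = f t"
  shows "(\<integral>\<^sup>+t. f (h t) \<partial>circ) = (\<integral>\<^sup>+t. f t \<partial>circ)"
  using assms unfolding circle_map_def by blast

lemma circle_map_integrable_iff:
  fixes f :: "real \<Rightarrow> real"
  assumes h: "circle_map h" and [measurable]: "f \<in> borel_measurable borel"
    and per: "\<And>t. f (t + 2*pi) = f t"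
  shows "integrable circ (\<lambda>t. f (h t)) \<longleftrightarrow> integrable circ f"
proof -
  have [measurable]: "h \<in> borel_measurable borel"
    using h by (simp add: circle_map_def)
  have "(\<integral>\<^sup>+t. ennreal (norm (f (h t))) \<partial>circ) = (\<integral>\<^sup>+t. ennreal (norm (f t)) \<partial>circ)"
    by (rule circle_map_nn_integral[OF h, of "\<lambda>t. ennreal (norm (f t))"]) (auto simp: per)
  then show ?thesis
    unfolding integrable_iff_bounded by simp
qed

lemma circle_map_integral:
  fixes f :: "real \<Rightarrow> real"
  assumes h: "circle_map h" and [measurable]: "f \<in> borel_measurable borel"
    and per: "\<And>t. f (t + 2*pi) = f t"
  shows "(\<integral>t. f (h t) \<partial>circ) = (\<integral>t. f t \<partial>circ)"
proof (cases "integrable circ f")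
  case True
  then have "integrable circ (\<lambda>t. f (h t))"
    using circle_map_integrable_iff[OF assms] by simp
  moreover have "(\<integral>\<^sup>+t. ennreal (f (h t)) \<partial>circ) = (\<integral>\<^sup>+t. ennreal (f t) \<partial>circ)"
    by (rule circle_map_nn_integral[OF h, of "\<lambda>t. ennreal (f t)"]) (auto simp: per)
  moreover have "(\<integral>\<^sup>+t. ennreal (- f (h t)) \<partial>circ) = (\<integral>\<^sup>+t. ennreal (- f t) \<partial>circ)"
    by (rule circle_map_nn_integral[OF h, of "\<lambda>t. ennreal (- f t)"]) (auto simp: per)
  ultimately show ?thesis
    using True by (simp add: real_lebesgue_integral_def)
next
  case False
  then show ?thesis
    using circle_map_integrable_iff[OF assms] by (simp add: not_integrable_integral_eq)
qed

section \<open>Jensen's formula for 1 + z x with |z| at most 1\<close>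

lemma cis_2pi_periodic: "cis (t + 2*pi) = cis t"
  by (simp add: cis.code)

lemma countable_cis_eq: "countable {t. cis t = u}"
proof (cases "\<exists>s. cis s = u")
  case True
  then obtain s where s: "cis s = u" by blast
  have "{t. cis t = u} \<subseteq> range (\<lambda>n::int. s + 2 * pi * n)"
  proof safe
    fix t assume "u = cis t"
    then have "cos t = cos s" "sin t = sin s"
      using s by (simp_all add: complex_eq_iff)
    then obtain n :: int where "t = s + 2 * pi * n"
      using sin_cos_eq_iff by (metis mult.commute)
    then show "t \<in> range (\<lambda>n::int. s + 2 * pi * n)" by blast
  qed
  then show ?thesis
    by (rule countable_subset) simp
qed simp

text \<open>Since \<open>ln 0 = 0\<close>, the law ln (a b) = ln a + ln b fails when a factor
  vanishes; such points form a countable set and are discarded here.\<close>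

lemma AE_one_plus_cis_nonzero: "AE t in circ. 1 + z * cis t \<noteq> 0"
proof -
  have "AE t in circ. t \<notin> {t. cis t = - inverse z}"
    by (intro AE_circ_countable countable_cis_eq)
  then show ?thesis
  proof eventually_elim
    case (elim t)
    show ?case
    proof
      assume "1 + z * cis t = 0"
      then have "z * cis t = -1" by (simp add: eq_neg_iff_add_eq_0 add.commute)
      then have "cis t = - inverse z"
        by (metis inverse_minus_eq inverse_inverse_eq inverse_mult_distrib inverse_unique
            mult.commute mult_minus_right mult.right_neutral minus_minus minus_equation_iff)
      with elim show False by simp
    qed
  qed
qed

lemma measurable_cis [measurable]: "cis \<in> borel_measurable borel"
  by (intro borel_measurable_continuous_onI continuous_intros)

text \<open>This is (1 + z x) (1 - z x) = 1 - z^2 x^2 on the circle: a half-turn replaces z by -z,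
  and doubling the angle replaces x^2 by x.\<close>

lemma circ_log_double:
  assumes int: "integrable circ (\<lambda>t. ln (cmod (1 + z * cis t)))"
  shows "2 * (\<integral>t. ln (cmod (1 + z * cis t)) \<partial>circ) = (\<integral>t. ln (cmod (1 + (-(z^2)) * cis t)) \<partial>circ)"
proof -
  let ?f = "\<lambda>t. ln (cmod (1 + z * cis t))"
  have per: "?f (t + 2*pi) = ?f t" for t
    by (simp add: cis_2pi_periodic)
  have sh: "circle_map (\<lambda>t. t + pi)"
    by (rule circle_map_shift) auto
  have int': "integrable circ (\<lambda>t. ?f (t + pi))"
    using circle_map_integrable_iff[of _ ?f, OF sh _ per] int by simp
  have "2 * (\<integral>t. ?f t \<partial>circ) = (\<integral>t. ?f t \<partial>circ) + (\<integral>t. ?f (t + pi) \<partial>circ)"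
    using circle_map_integral[of _ ?f, OF sh _ per] by simp
  also have "\<dots> = (\<integral>t. ?f t + ?f (t + pi) \<partial>circ)"
    using int int' by simp
  also have "\<dots> = (\<integral>t. ln (cmod (1 + (-(z^2)) * cis (2 * t))) \<partial>circ)"
  proof (intro integral_cong_AE)
    show "AE t in circ. ?f t + ?f (t + pi) = ln (cmod (1 + (-(z^2)) * cis (2 * t)))"
      using AE_one_plus_cis_nonzero[of z] AE_one_plus_cis_nonzero[of "-z"]
    proof eventually_elim
      case (elim t)
      have "cis (2 * t) = cis t ^ 2"
        by (simp add: power2_eq_square cis_mult)
      then have "1 + (-(z^2)) * cis (2 * t) = (1 + z * cis t) * (1 + (-z) * cis t)"
        by (simp add: algebra_simps power2_eq_square)
      moreover have "cis (t + pi) = - cis t"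
        by (simp add: minus_cis)
      ultimately show ?case
        using elim by (simp add: norm_mult ln_mult)
    qed
  qed auto
  also have "\<dots> = (\<integral>t. ln (cmod (1 + (-(z^2)) * cis t)) \<partial>circ)"
    by (rule circle_map_integral[OF circle_map_double, of "\<lambda>t. ln (cmod (1 + (-(z^2)) * cis t))"]) (auto simp: cis_2pi_periodic)
  finally show ?thesis .
qed

text \<open>Iterating the duplication identity divides the integral by \<open>2^n\<close> while the bound stays fixed.\<close>
lemma circ_log_zero_if_bounded:
  assumes int: "\<And>z. z \<in> S \<Longrightarrow> integrable circ (\<lambda>t. ln (cmod (1 + z * cis t)))"
    and bnd: "\<And>z. z \<in> S \<Longrightarrow> \<bar>\<integral>t. ln (cmod (1 + z * cis t)) \<partial>circ\<bar> \<le> B"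
    and S: "\<And>z. z \<in> S \<Longrightarrow> -(z^2) \<in> S" and z: "z \<in> S"
  shows "(\<integral>t. ln (cmod (1 + z * cis t)) \<partial>circ) = 0"
proof -
  let ?J = "\<lambda>z. \<integral>t. ln (cmod (1 + z * cis t)) \<partial>circ"
  have "\<bar>?J z\<bar> * 2 ^ n \<le> B" if "z \<in> S" for n z
    using that
  proof (induction n arbitrary: z)
    case 0
    then show ?case using bnd by simp
  next
    case (Suc n)
    have "\<bar>?J z\<bar> * 2 ^ Suc n = \<bar>2 * ?J z\<bar> * 2 ^ n"
      by simp
    also have "2 * ?J z = ?J (-(z^2))"
      using circ_log_double int Suc.prems by blast
    finally show ?case
      using Suc.IH S Suc.prems by metis
  qed
  with z have *: "\<bar>?J z\<bar> * 2 ^ n \<le> B" for n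
    by blast
  show ?thesis
  proof (rule ccontr)
    assume "?J z \<noteq> 0"
    then have "\<bar>?J z\<bar> > 0" by simp
    then obtain n where "B / \<bar>?J z\<bar> < 2 ^ n"
      using real_arch_pow[of 2] by auto
    with \<open>\<bar>?J z\<bar> > 0\<close> have "B < \<bar>?J z\<bar> * 2 ^ n"
      by (simp add: field_simps)
    with *[of n] show False by simp
  qed
qed

text \<open>A closed disc of radius r < 1 is stable under z -> -z^2, and on it the logarithm is
  bounded uniformly because |1 + z x| stays between 1 - r and 2.\<close>

lemma circ_log_zero_interior:
  assumes "cmod z < 1"
  shows "integrable circ (\<lambda>t. ln (cmod (1 + z * cis t)))"
    and "(\<integral>t. ln (cmod (1 + z * cis t)) \<partial>circ) = 0"
proof -
  define r where "r = cmod z"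
  define S where "S = {w. cmod w \<le> r}"
  define B where "B = ln 2 - ln (1 - r)"
  have r: "0 \<le> r" "r < 1" using assms by (auto simp: r_def)
  have B0: "B \<ge> 0" using r ln_le_zero_iff[of "1-r"] unfolding B_def by (smt (verit) ln_gt_zero)
  have pt: "\<bar>ln (cmod (1 + w * cis t))\<bar> \<le> B" if "w \<in> S" for w t
  proof -
    have "cmod (w * cis t) \<le> r" using that by (simp add: S_def norm_mult)
    then have lo: "1 - r \<le> cmod (1 + w * cis t)" and hi: "cmod (1 + w * cis t) \<le> 2"
      using norm_triangle_ineq[of 1 "w * cis t"] norm_diff_ineq[of 1 "w * cis t"] r by auto
    have "ln (1 - r) \<le> ln (cmod (1 + w * cis t))" "ln (cmod (1 + w * cis t)) \<le> ln 2"
      using lo hi r by (auto intro!: ln_mono)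
    moreover have "ln (1 - r) \<le> 0" "(ln 2 :: real) \<ge> 0" using r by auto
    ultimately show ?thesis unfolding B_def by linarith
  qed
  have int: "integrable circ (\<lambda>t. ln (cmod (1 + w * cis t)))" if "w \<in> S" for w
    by (rule circ.integrable_const_bound[where B = B]) (use pt[OF that] in auto)
  have bnd: "\<bar>\<integral>t. ln (cmod (1 + w * cis t)) \<partial>circ\<bar> \<le> 2 * pi * B" if "w \<in> S" for w
  proof -
    have "\<bar>\<integral>t. ln (cmod (1 + w * cis t)) \<partial>circ\<bar> \<le> (\<integral>t. \<bar>ln (cmod (1 + w * cis t))\<bar> \<partial>circ)"
      using integral_norm_bound[of circ "\<lambda>t. ln (cmod (1 + w * cis t))"] by simp
    also have "\<dots> \<le> (\<integral>t. B \<partial>circ)"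
      using int[OF that] pt[OF that] by (intro integral_mono) auto
    finally show ?thesis by (simp only: integral_circ_const)
  qed
  have S: "-(w^2) \<in> S" if "w \<in> S" for w
  proof -
    have "cmod w ^ 2 \<le> r * 1"
      using that r unfolding S_def power2_eq_square by (intro mult_mono) auto
    then show ?thesis by (simp add: S_def norm_power)
  qed
  have z: "z \<in> S" by (simp add: S_def r_def)
  show "integrable circ (\<lambda>t. ln (cmod (1 + z * cis t)))" using int z .
  show "(\<integral>t. ln (cmod (1 + z * cis t)) \<partial>circ) = 0"
    using circ_log_zero_if_bounded[of S, OF int bnd S z] .
qed

text \<open>For |z| = 1 the logarithm is unbounded. Approaching z along its radius from inside the
  disc and applying Fatou's lemma to the nonnegative function ln 2 - ln |1 + z x| still bounds the
  integral, since inside the disc it has the constant value 2 pi ln 2.\<close>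

lemma circ_log_nn_bound:
  assumes z: "cmod z \<le> 1"
  shows "(\<integral>\<^sup>+t. ennreal (ln 2 - ln (cmod (1 + z * cis t))) \<partial>circ) \<le> ennreal (2 * pi * ln 2)"
proof -
  define r where "r n = 1 + - inverse (real (Suc n))" for n
  have r: "0 \<le> r n" "r n < 1" for n by (auto simp: r_def field_simps)
  have r_lim: "r \<longlonglongrightarrow> 1"
    unfolding r_def by (rule LIMSEQ_inverse_real_of_nat_add_minus)
  define w where "w n = of_real (r n) * z" for n
  have w1: "cmod (w n) < 1" for n
  proof -
    have "cmod (w n) = r n * cmod z" using r by (simp add: w_def norm_mult)
    also have "\<dots> \<le> r n * 1" using r z by (intro mult_left_mono) auto
    finally show ?thesis using r[of n] by simp
  qed
  have w_lim: "w \<longlonglongrightarrow> z"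
    unfolding w_def using tendsto_mult[OF tendsto_of_real[OF r_lim] tendsto_const[of z]] by simp
  let ?g = "\<lambda>z t. ennreal (ln 2 - ln (cmod (1 + z * cis t)))"
  have eq: "(\<integral>\<^sup>+t. ?g (w n) t \<partial>circ) = ennreal (2 * pi * ln 2)" for n
  proof -
    have "AE t in circ. 0 \<le> ln 2 - ln (cmod (1 + w n * cis t))"
      using AE_one_plus_cis_nonzero[of "w n"]
    proof eventually_elim
      case (elim t)
      have "cmod (1 + w n * cis t) \<le> 2"
        using norm_triangle_ineq[of 1 "w n * cis t"] w1[of n] by (simp add: norm_mult)
      then show ?case using elim by (simp add: ln_mono)
    qed
    then have "(\<integral>\<^sup>+t. ?g (w n) t \<partial>circ) = ennreal (\<integral>t. ln 2 - ln (cmod (1 + w n * cis t)) \<partial>circ)"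
      using circ_log_zero_interior(1)[OF w1[of n]] by (intro nn_integral_eq_integral) auto
    then show ?thesis
      using circ_log_zero_interior[OF w1[of n]] by (simp add: measure_circ_UNIV)
  qed
  have "(\<integral>\<^sup>+t. ?g z t \<partial>circ) = (\<integral>\<^sup>+t. liminf (\<lambda>n. ?g (w n) t) \<partial>circ)"
  proof (rule nn_integral_cong_AE)
    show "AE t in circ. ?g z t = liminf (\<lambda>n. ?g (w n) t)"
      using AE_one_plus_cis_nonzero[of z]
    proof eventually_elim
      case (elim t)
      have "(\<lambda>n. ?g (w n) t) \<longlonglongrightarrow> ?g z t"
        using elim by (intro tendsto_ennrealI tendsto_intros w_lim) auto
      from lim_imp_Liminf[OF _ this] show ?case by simp
    qed
  qed
  also have "\<dots> \<le> liminf (\<lambda>n. \<integral>\<^sup>+t. ?g (w n) t \<partial>circ)"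
    by (rule nn_integral_liminf) auto
  also have "\<dots> = ennreal (2 * pi * ln 2)"
    unfolding eq by (simp add: Liminf_const)
  finally show ?thesis .
qed

text \<open>This is the uniform bound on the closed unit disc, which lets the duplication argument
  reach |z| = 1.\<close>

lemma circ_log_abs_bound:
  assumes z: "cmod z \<le> 1"
  shows "integrable circ (\<lambda>t. ln (cmod (1 + z * cis t)))"
    and "(\<integral>t. \<bar>ln (cmod (1 + z * cis t))\<bar> \<partial>circ) \<le> 4 * pi * ln 2"
proof -
  let ?f = "\<lambda>t. ln (cmod (1 + z * cis t))"
  have AE: "AE t in circ. 0 \<le> ln 2 - ?f t"
    using AE_one_plus_cis_nonzero[of z]
  proof eventually_elim
    case (elim t)
    have "cmod (1 + z * cis t) \<le> 2"
      using norm_triangle_ineq[of 1 "z * cis t"] z by (simp add: norm_mult)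
    then show ?case using elim by (simp add: ln_mono)
  qed
  have int1: "integrable circ (\<lambda>t. ln 2 - ?f t)"
  proof (rule integrableI_nonneg[OF _ AE])
    show "(\<integral>\<^sup>+t. ennreal (ln 2 - ?f t) \<partial>circ) < \<infinity>"
      using circ_log_nn_bound[OF z] by (simp add: order_le_less_trans)
  qed auto
  have le: "(\<integral>t. ln 2 - ?f t \<partial>circ) \<le> 2 * pi * ln 2"
    using circ_log_nn_bound[OF z] nn_integral_eq_integral[OF int1 AE] by simp
  have "integrable circ (\<lambda>t. ln 2 - (ln 2 - ?f t))"
    by (rule Bochner_Integration.integrable_diff[OF _ int1]) simp
  then show int: "integrable circ ?f" by simp
  have "(\<integral>t. \<bar>?f t\<bar> \<partial>circ) \<le> (\<integral>t. ln 2 + (ln 2 - ?f t) \<partial>circ)"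
  proof (intro integral_mono_AE)
    show "AE t in circ. \<bar>?f t\<bar> \<le> ln 2 + (ln 2 - ?f t)"
      using AE by eventually_elim (use ln_gt_zero[of "2::real"] in linarith)
  qed (use int in auto)
  also have "\<dots> = 2 * pi * ln 2 + (\<integral>t. ln 2 - ?f t \<partial>circ)"
    using int1 by (subst Bochner_Integration.integral_add) (auto simp: measure_circ_UNIV)
  finally show "(\<integral>t. \<bar>?f t\<bar> \<partial>circ) \<le> 4 * pi * ln 2" using le by simp
qed

lemma circ_log_zero:
  assumes z: "cmod z \<le> 1"
  shows "(\<integral>t. ln (cmod (1 + z * cis t)) \<partial>circ) = 0"
proof (rule circ_log_zero_if_bounded[of "{z. cmod z \<le> 1}"])
  fix z :: complex assume z: "z \<in> {z. cmod z \<le> 1}"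
  then show "integrable circ (\<lambda>t. ln (cmod (1 + z * cis t)))"
    using circ_log_abs_bound by simp
  show "\<bar>\<integral>t. ln (cmod (1 + z * cis t)) \<partial>circ\<bar> \<le> 4 * pi * ln 2"
    using integral_norm_bound[of circ "\<lambda>t. ln (cmod (1 + z * cis t))"] circ_log_abs_bound(2)[of z] z
    unfolding real_norm_def mem_Collect_eq by (meson order_trans)
  show "-(z^2) \<in> {z. cmod z \<le> 1}"
    using z by (simp add: norm_power power_le_one)
qed (use z in simp)

text \<open>Each linear factor has mean 0, so only ln c survives. The bound on the absolute value
  serves to establish integrability on the torus before Fubini's theorem is applied.\<close>

lemma circ_log_product:
  assumes z: "cmod z \<le> 1" "cmod w \<le> 1" and c: "c > 0"
    and F: "\<And>t. cmod (F t) = c * cmod (1 + z * cis t) * cmod (1 + w * cis t)"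
  shows "integrable circ (\<lambda>t. ln (cmod (F t)))"
    and "(\<integral>t. ln (cmod (F t)) \<partial>circ) = 2 * pi * ln c"
    and "(\<integral>t. \<bar>ln (cmod (F t))\<bar> \<partial>circ) \<le> 2 * pi * \<bar>ln c\<bar> + 8 * pi * ln 2"
proof -
  let ?g = "\<lambda>t. ln c + ln (cmod (1 + z * cis t)) + ln (cmod (1 + w * cis t))"
  have meas [measurable]: "(\<lambda>t. ln (cmod (F t))) \<in> borel_measurable circ"
    unfolding F by measurable
  have AE: "AE t in circ. ln (cmod (F t)) = ?g t"
    using AE_one_plus_cis_nonzero[of z] AE_one_plus_cis_nonzero[of w]
    by eventually_elim (use c in \<open>simp add: F ln_mult\<close>)
  have ig: "integrable circ ?g"
    using circ_log_abs_bound(1) z by auto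
  then show int: "integrable circ (\<lambda>t. ln (cmod (F t)))"
    using integrable_cong_AE[OF _ _ AE] by simp
  have "(\<integral>t. ln (cmod (F t)) \<partial>circ) = (\<integral>t. ?g t \<partial>circ)"
    by (rule integral_cong_AE[OF _ _ AE]) auto
  also have "\<dots> = 2 * pi * ln c"
    using circ_log_abs_bound(1) circ_log_zero z by (simp add: measure_circ_UNIV)
  finally show "(\<integral>t. ln (cmod (F t)) \<partial>circ) = 2 * pi * ln c" .
  have "(\<integral>t. \<bar>ln (cmod (F t))\<bar> \<partial>circ) \<le>
     (\<integral>t. \<bar>ln c\<bar> + (\<bar>ln (cmod (1 + z * cis t))\<bar> + \<bar>ln (cmod (1 + w * cis t))\<bar>) \<partial>circ)"
  proof (intro integral_mono_AE)
    show "AE t in circ. \<bar>ln (cmod (F t))\<bar> \<le> \<bar>ln c\<bar> + (\<bar>ln (cmod (1 + z * cis t))\<bar> + \<bar>ln (cmod (1 + w * cis t))\<bar>)"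
      using AE by eventually_elim linarith
  qed (use int circ_log_abs_bound(1) z in auto)
  also have "\<dots> = 2 * pi * \<bar>ln c\<bar> + ((\<integral>t. \<bar>ln (cmod (1 + z * cis t))\<bar> \<partial>circ) + (\<integral>t. \<bar>ln (cmod (1 + w * cis t))\<bar> \<partial>circ))"
    using circ_log_abs_bound(1) z by (simp add: measure_circ_UNIV)
  also have "\<dots> \<le> 2 * pi * \<bar>ln c\<bar> + 8 * pi * ln 2"
    using circ_log_abs_bound(2)[OF z(1)] circ_log_abs_bound(2)[OF z(2)] by linarith
  finally show "(\<integral>t. \<bar>ln (cmod (F t))\<bar> \<partial>circ) \<le> 2 * pi * \<bar>ln c\<bar> + 8 * pi * ln 2" .
qed

section \<open>The isogeny between the two periods\<close>

text \<open>With x = e^(i t), one has 2 + 2 cos t = |1 + x|^2 and |1 + 2 cos t| = |x^2 + x + 1|.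
  This is the discriminant of \<open>P\<close> in y, after the normalisation in
  \<open>cmod_P_poly\<close> that makes the coefficients real.\<close>

definition P_disc :: "real \<Rightarrow> real \<Rightarrow> real" where
  "P_disc k t = k^2 * (2 + 2 * cos t) - 4 * (1 + 2 * cos t)^2"

text \<open>The derivative of \<open>P_inner\<close> in k. When the discriminant is negative, the
  roots form a conjugate pair on the unit circle and \<open>P_inner\<close> is locally constant in
  k, hence the value 0.\<close>

definition P_kernel :: "real \<Rightarrow> real \<Rightarrow> real" where
  "P_kernel k t = (if P_disc k t > 0 then sqrt (2 + 2 * cos t) / sqrt (P_disc k t) else 0)"

text \<open>A quarter of the discriminant of the quadratic in x that arises from \<open>R\<close>
  after y = x w, with w = e^(i t).\<close>

definition R_disc :: "real \<Rightarrow> real \<Rightarrow> real" where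
  "R_disc k t = 4 * (cos t)^2 + 2 * cos t - 2 + k^2 / 4"

definition R_kernel :: "real \<Rightarrow> real \<Rightarrow> real" where
  "R_kernel k t = 1 / (2 * sqrt (R_disc k t))"

lemma two_plus_two_cos_nonneg: "0 \<le> 2 + 2 * cos (t::real)"
  using cos_ge_minus_one[of t] by linarith

lemma P_kernel_nonneg: "0 \<le> P_kernel k t"
  using two_plus_two_cos_nonneg[of t] by (auto simp: P_kernel_def)

lemma R_disc_pos:
  assumes "k > 3"
  shows "R_disc k t > 0"
proof -
  have "R_disc k t = (2 * cos t + 1/2)^2 + (k^2 - 9) / 4"
    by (simp add: R_disc_def power2_eq_square field_simps)
  moreover have "k^2 > 3^2"
    using assms by (intro power_strict_mono) auto
  ultimately show ?thesis
    by (simp add: add_nonneg_pos)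
qed

lemma measurable_P_kernel_pair [measurable]: "(\<lambda>(k, t). P_kernel k t) \<in> borel_measurable (borel \<Otimes>\<^sub>M borel)"
  unfolding P_kernel_def P_disc_def by measurable

lemma measurable_R_kernel_pair [measurable]: "(\<lambda>(k, t). R_kernel k t) \<in> borel_measurable (borel \<Otimes>\<^sub>M borel)"
  unfolding R_kernel_def R_disc_def by measurable

lemma measurable_P_kernel [measurable]: "P_kernel k \<in> borel_measurable borel"
  unfolding P_kernel_def P_disc_def by measurable

lemma measurable_R_kernel [measurable]: "R_kernel k \<in> borel_measurable borel"
  unfolding R_kernel_def R_disc_def by measurable

lemma nn_integral_circ_even:
  fixes f :: "real \<Rightarrow> ennreal"
  assumes [measurable]: "f \<in> borel_measurable borel" and ev: "\<And>t. f (2 * pi - t) = f t"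
  shows "(\<integral>\<^sup>+t. f t \<partial>circ) = 2 * (\<integral>\<^sup>+t. f t * indicator {0..pi} t \<partial>lborel)"
proof -
  have "(\<integral>\<^sup>+t. f t * indicator {pi..2*pi} t \<partial>lborel) =
     (\<integral>\<^sup>+t. f (2 * pi - t) * indicator {pi..2*pi} (2 * pi - t) \<partial>lborel)"
    by (subst nn_integral_real_affine[where c = "-1" and t = "2*pi"]) auto
  also have "\<dots> = (\<integral>\<^sup>+t. f t * indicator {0..pi} t \<partial>lborel)"
    by (intro nn_integral_cong) (auto simp: ev indicator_def)
  finally have *: "(\<integral>\<^sup>+t. f t * indicator {pi..2*pi} t \<partial>lborel) = (\<integral>\<^sup>+t. f t * indicator {0..pi} t \<partial>lborel)" .
  have "(\<integral>\<^sup>+t. f t \<partial>circ) = (\<integral>\<^sup>+t. f t * indicator {0..pi} t \<partial>lborel) + (\<integral>\<^sup>+t. f t * indicator {pi..2*pi} t \<partial>lborel)"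
    by (simp add: nn_integral_circ nn_integral_split_Icc[of 0 pi "2*pi"])
  then show ?thesis
    unfolding * by (subst mult_2)
qed

context
  fixes k c :: real
  assumes k: "k > 3" and c: "c = k^2 / 4"
begin

text \<open>
  The elliptic curves underlying the two periods are 2-isogenous. In the coordinates
  \<open>T = 2 + 2 cos s\<close> for \<open>P\<close> and \<open>t = 2 + 2 cos \<phi>\<close> for \<open>R\<close>, the isogeny followed by a translation
  by a 2-torsion point is \<open>T = 4 - (4c - 9) t (4 - t) / (4 (t^2 - 3t + c))\<close>.
  In terms of angles this is \<open>s = isoS \<phi>\<close>, with derivative \<open>isoS'\<close>.
\<close>
definition "isoD C = 4 * C^2 + 2 * C + c - 2" for C :: real
definition "isoM C = (4 * c + 7) * C^2 + 8 * C + 1" for C :: real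
definition "isoN C = C^2 + (c + 2) * C + 1" for C :: real
definition "isoU t = sqrt (4 * c - 9) * sin t / (2 * sqrt (isoD (cos t)))" for t :: real
definition "isoS t = 2 * arcsin (isoU t)" for t :: real
definition "isoS' t = 2 * sqrt (4 * c - 9) * isoN (cos t) / (isoD (cos t) * sqrt (isoM (cos t)))" for t :: real

lemma c_gt: "4 * c > 9"
  using k power_strict_mono[of 3 k 2] by (simp add: c)

lemma isoD_pos: "isoD C > 0"
proof -
  have "isoD C = (2 * C + 1/2)^2 + (c - 9/4)"
    by (simp add: isoD_def power2_eq_square field_simps)
  then show ?thesis
    using c_gt by (simp add: add_nonneg_pos)
qed

lemma isoM_pos: "isoM C > 0"
proof -
  have p: "4 * c + 7 > 0" using c_gt by simp
  have "(4 * c + 7) * isoM C = ((4 * c + 7) * C + 4)^2 + (4 * c - 9)"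
    by (simp add: isoM_def power2_eq_square algebra_simps)
  then have "(4 * c + 7) * isoM C > 0"
    using c_gt by (simp add: add_nonneg_pos)
  with p show ?thesis
    by (simp add: zero_less_mult_iff)
qed

text \<open>The algebraic core of the isogeny. With T = \<open>isoM\<close> / \<open>isoD\<close>,
  the discriminant for \<open>P\<close> is 4 (c T - (T - 1)^2), and this says that its pullback is a
  constant times a square.\<close>

lemma iso_identity: "c * isoM C * isoD C - (isoM C - isoD C)^2 = (4 * c - 9) * (isoN C)^2"
  by (simp add: isoM_def isoD_def isoN_def power2_eq_square algebra_simps)

text \<open>\<open>isoU\<close> is the sine of half the angle \<open>isoS\<close>, so 4 (1 -
  \<open>isoU\<close>^2) is the coordinate T. Positivity of \<open>isoM\<close> then keeps arcsin
  away from its singular endpoints.\<close>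

lemma isoU_sq: "1 - (isoU t)^2 = isoM (cos t) / (4 * isoD (cos t))"
proof -
  have s: "(sin t)^2 = 1 - (cos t)^2" by (simp add: sin_squared_eq)
  have "(isoU t)^2 = (4 * c - 9) * (1 - (cos t)^2) / (4 * isoD (cos t))"
    using c_gt isoD_pos[of "cos t"] by (simp add: isoU_def power_divide power_mult_distrib s)
  moreover have "4 * isoD (cos t) - (4 * c - 9) * (1 - (cos t)^2) = isoM (cos t)"
    by (simp add: isoM_def isoD_def algebra_simps)
  ultimately show ?thesis
    using isoD_pos[of "cos t"] by (simp add: field_simps)
qed

lemma isoU_bounds: "-1 < isoU t" "isoU t < 1"
proof -
  have "1 - (isoU t)^2 > 0"
    unfolding isoU_sq using isoM_pos isoD_pos by simp
  then have "(isoU t)^2 < 1^2" by simp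
  then have "\<bar>isoU t\<bar> < 1"
    by (metis abs_1 abs_le_square_iff linorder_not_le)
  then show "-1 < isoU t" "isoU t < 1" by auto
qed

lemma cos_isoS: "2 + 2 * cos (isoS t) = isoM (cos t) / isoD (cos t)"
proof -
  have "2 + 2 * cos (isoS t) = 4 * (1 - (isoU t)^2)"
    unfolding isoS_def cos_double_sin using isoU_bounds[of t] by simp
  then show ?thesis
    unfolding isoU_sq by simp
qed

lemma isoU_deriv:
  "(isoU has_real_derivative (sqrt (4 * c - 9) / 2 * (isoN (cos t) / (isoD (cos t) * sqrt (isoD (cos t)))))) (at t)"
proof -
  define d where "d = sqrt (isoD (cos t))"
  have d: "d > 0" "d^2 = isoD (cos t)"
    using isoD_pos[of "cos t"] by (auto simp: d_def)
  have D': "((\<lambda>t. isoD (cos t)) has_real_derivative (- sin t * (8 * cos t + 2))) (at t)"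
    unfolding isoD_def
    by (auto intro!: derivative_eq_intros simp: algebra_simps)
  have sq: "((\<lambda>t. sqrt (isoD (cos t))) has_real_derivative (- sin t * (8 * cos t + 2)) * (inverse d / 2)) (at t)"
    using DERIV_chain2[OF DERIV_real_sqrt[OF isoD_pos] D'] by (simp add: d_def mult.commute)
  have "(isoU has_real_derivative
      (sqrt (4 * c - 9) * cos t * (2 * d) - sqrt (4 * c - 9) * sin t * (2 * ((- sin t * (8 * cos t + 2)) * (inverse d / 2)))) / ((2 * d) * (2 * d))) (at t)"
    unfolding isoU_def d_def
    by (rule DERIV_divide)
       (use isoD_pos[of "cos t"] DERIV_cmult[OF sq, of 2] in \<open>auto intro!: DERIV_cmult DERIV_sin simp: d_def\<close>)
  moreover have "(sqrt (4 * c - 9) * cos t * (2 * d) - sqrt (4 * c - 9) * sin t * (2 * ((- sin t * (8 * cos t + 2)) * (inverse d / 2)))) / ((2 * d) * (2 * d))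
     = sqrt (4 * c - 9) / 2 * ((cos t * d^2 + (sin t)^2 * (4 * cos t + 1)) / (d^2 * d))"
    using d(1) by (simp add: field_simps power2_eq_square)
  moreover have "cos t * d^2 + (sin t)^2 * (4 * cos t + 1) = isoN (cos t)"
    unfolding d(2) sin_squared_eq isoD_def isoN_def by (simp add: power2_eq_square algebra_simps)
  ultimately show ?thesis
    using d(2) by (simp add: d_def)
qed

lemma isoS_deriv: "(isoS has_real_derivative isoS' t) (at t)"
proof -
  have "(isoS has_real_derivative 2 * (inverse (sqrt (1 - (isoU t)^2)) *
      (sqrt (4 * c - 9) / 2 * (isoN (cos t) / (isoD (cos t) * sqrt (isoD (cos t))))))) (at t)"
    unfolding isoS_def
    by (intro DERIV_cmult DERIV_chain2[OF DERIV_arcsin isoU_deriv] isoU_bounds)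
  moreover have "2 * (inverse (sqrt (1 - (isoU t)^2)) *
      (sqrt (4 * c - 9) / 2 * (isoN (cos t) / (isoD (cos t) * sqrt (isoD (cos t)))))) = isoS' t"
    using isoM_pos[of "cos t"] isoD_pos[of "cos t"]
    by (simp add: isoU_sq isoS'_def real_sqrt_divide real_sqrt_mult field_simps)
  ultimately show ?thesis by simp
qed

lemma P_disc_isoS: "P_disc k (isoS t) = 4 * (4 * c - 9) * (isoN (cos t) / isoD (cos t))^2"
proof -
  let ?M = "isoM (cos t)" and ?D = "isoD (cos t)"
  have "P_disc k (isoS t) = 4 * c * (?M / ?D) - 4 * (?M / ?D - 1)^2"
  proof -
    have *: "1 + 2 * cos (isoS t) = ?M / ?D - 1"
      using cos_isoS[of t] by linarith
    have "k^2 = 4 * c" by (simp add: c)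
    then show ?thesis
      unfolding P_disc_def cos_isoS * by (simp only:)
  qed
  also have "\<dots> = 4 * (c * ?M * ?D - (?M - ?D)^2) / ?D^2"
    using isoD_pos[of "cos t"] by (simp add: field_simps power2_eq_square)
  also have "\<dots> = 4 * (4 * c - 9) * (isoN (cos t) / ?D)^2"
    unfolding iso_identity by (simp add: power_divide)
  finally show ?thesis .
qed

text \<open>The square root of the pulled-back discriminant contributes |\<open>isoN\<close>|, which
  cancels against the derivative of \<open>isoS\<close>, as does the square root of
  \<open>isoM\<close>. What remains is twice \<open>R_kernel\<close>.\<close>

lemma P_kernel_isoS:
  assumes "isoN (cos t) \<noteq> 0"
  shows "P_kernel k (isoS t) * \<bar>isoS' t\<bar> = 1 / sqrt (isoD (cos t))"
proof -
  let ?M = "isoM (cos t)" and ?D = "isoD (cos t)" and ?N = "isoN (cos t)"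
  have pos: "?M > 0" "?D > 0" "4 * c - 9 > 0"
    using isoM_pos isoD_pos c_gt by auto
  have "P_disc k (isoS t) > 0"
    unfolding P_disc_isoS using assms pos by simp
  then have "P_kernel k (isoS t) = sqrt (?M / ?D) / sqrt (4 * (4 * c - 9) * (?N / ?D)^2)"
    unfolding P_kernel_def cos_isoS P_disc_isoS by simp
  also have "4 * (4 * c - 9) * (?N / ?D)^2 = (2 * (?N / ?D))^2 * (4 * c - 9)"
    by (simp only: power_mult_distrib) simp
  also have "sqrt (?M / ?D) / sqrt \<dots> = sqrt ?M / sqrt ?D / (2 * sqrt (4 * c - 9) * (\<bar>?N\<bar> / ?D))"
    unfolding real_sqrt_mult real_sqrt_divide real_sqrt_abs using pos by (simp add: abs_mult)
  finally have 1: "P_kernel k (isoS t) = sqrt ?M / sqrt ?D / (2 * sqrt (4 * c - 9) * (\<bar>?N\<bar> / ?D))" .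
  have 2: "\<bar>isoS' t\<bar> = 2 * sqrt (4 * c - 9) * \<bar>?N\<bar> / (?D * sqrt ?M)"
    unfolding isoS'_def using pos by (simp add: abs_mult)
  show ?thesis
    unfolding 1 2 using pos assms by (simp add: field_simps)
qed

lemma continuous_on_isoS': "continuous_on A isoS'"
proof -
  have nz: "isoD (cos t) * sqrt (isoM (cos t)) \<noteq> 0" for t
    using isoM_pos[of "cos t"] isoD_pos[of "cos t"] by simp
  have "continuous_on A (\<lambda>t. isoN (cos t))" "continuous_on A (\<lambda>t. isoD (cos t))"
    "continuous_on A (\<lambda>t. isoM (cos t))"
    unfolding isoN_def isoD_def isoM_def by (intro continuous_intros)+
  then show ?thesis
    unfolding isoS'_def by (intro continuous_on_divide continuous_on_mult continuous_on_const continuous_on_real_sqrt) (use nz in auto)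
qed

text \<open>\<open>isoS\<close> increases until \<open>cos \<phi> = - \<tau>\<close> and then decreases back to \<open>0\<close>.\<close>
lemma turning_point: obtains \<tau> where "0 < \<tau>" "\<tau> < 1" "\<tau>^2 - (c + 2) * \<tau> + 1 = 0"
proof -
  let ?g = "\<lambda>x::real. - (x^2 - (c + 2) * x + 1)"
  have "\<exists>x\<ge>0. x \<le> 1 \<and> ?g x = 0"
    using c_gt by (intro IVT') (auto intro!: continuous_intros)
  then obtain x where x: "0 \<le> x" "x \<le> 1" "?g x = 0" by blast
  have "x \<noteq> 0" "x \<noteq> 1" using x(3) c_gt by auto
  with x show ?thesis by (intro that[of x]) auto
qed

text \<open>On the half circle from 0 to pi, \<open>isoS\<close> maps each of the pieces [0, a] and
  [a, pi] onto the same interval [0, s], and \<open>P_kernel\<close> vanishes beyond s. The two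
  pieces together give one full half-circle integral of 2 \<open>R_kernel\<close>, while [0, s]
  taken twice gives the full circle integral of \<open>P_kernel\<close>.\<close>

lemma period_identity: "(\<integral>\<^sup>+t. P_kernel k t \<partial>circ) = (\<integral>\<^sup>+t. R_kernel k t \<partial>circ)"
proof -
  obtain \<tau> where \<tau>: "0 < \<tau>" "\<tau> < 1" "\<tau>^2 - (c + 2) * \<tau> + 1 = 0"
    by (rule turning_point)
  have c_\<tau>: "c + 2 = \<tau> + 1 / \<tau>"
    using \<tau> by (simp add: field_simps power2_eq_square)
  have N_fact: "isoN C = (C + \<tau>) * (C + 1 / \<tau>)" for C
    unfolding isoN_def c_\<tau> using \<tau>(1) by (simp add: algebra_simps add_divide_distrib power2_eq_square)
  have inv\<tau>: "1 / \<tau> > 1" using \<tau> by simp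
  have N_pos: "C + 1 / \<tau> > 0" if "C \<ge> -1" for C
    using that inv\<tau> by linarith
  define a where "a = arccos (- \<tau>)"
  have cos_a: "cos a = - \<tau>" unfolding a_def using \<tau> by (intro cos_arccos) auto
  have a: "0 \<le> a" "a \<le> pi" unfolding a_def using \<tau> by (auto intro!: arccos_lbound arccos_ubound)
  have N_ge: "isoN (cos t) \<ge> 0" if "t \<in> {0..a}" for t
  proof -
    have "cos t \<ge> cos a" using that a by (intro cos_monotone_0_pi_le) auto
    then show ?thesis unfolding N_fact cos_a
      using N_pos[of "cos t"] by (intro mult_nonneg_nonneg) auto
  qed
  have N_le: "isoN (cos t) \<le> 0" if "t \<in> {a..pi}" for t
  proof -
    have "cos t \<le> cos a" using that a by (intro cos_monotone_0_pi_le) auto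
    then show ?thesis unfolding N_fact cos_a
      using N_pos[of "cos t"] by (intro mult_nonpos_nonneg) auto
  qed
  have N_nz: "isoN (cos t) \<noteq> 0" if "t \<in> {0..pi}" "t \<noteq> a" for t
  proof -
    have "cos t \<noteq> cos a" using that a cos_inj_pi by auto
    then show ?thesis unfolding N_fact cos_a
      using N_pos[of "cos t"] by auto
  qed
  have S'_ge: "isoS' t \<ge> 0" if "t \<in> {0..a}" for t
    unfolding isoS'_def using N_ge[OF that] isoD_pos[of "cos t"] isoM_pos[of "cos t"] c_gt by simp
  have S'_le: "isoS' t \<le> 0" if "t \<in> {a..pi}" for t
    unfolding isoS'_def using N_le[OF that] isoD_pos[of "cos t"] isoM_pos[of "cos t"] c_gt
    by (simp add: divide_nonpos_pos mult_nonneg_nonpos)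
  have S_0: "isoS 0 = 0" and S_pi: "isoS pi = 0"
    by (simp_all add: isoS_def isoU_def)
  define s where "s = isoS a"
  have s: "0 \<le> s" "s \<le> pi"
  proof -
    have "0 \<le> isoU a" unfolding isoU_def using a c_gt isoD_pos[of "cos a"] by (auto intro!: divide_nonneg_nonneg mult_nonneg_nonneg sin_ge_zero)
    then show "0 \<le> s" "s \<le> pi"
      using isoU_bounds[of a] arcsin_ubound[of "isoU a"] arcsin_le_arcsin[of 0 "isoU a"]
      unfolding s_def isoS_def by auto
  qed
  let ?h = "\<lambda>t. ennreal (1 / sqrt (isoD (cos t)))"
  have [measurable]: "(\<lambda>t. isoD (cos t)) \<in> borel_measurable borel"
    unfolding isoD_def by measurable
  have 1: "(\<integral>\<^sup>+t. ennreal (P_kernel k t) * indicator {0..s} t \<partial>lborel) = (\<integral>\<^sup>+t. ?h t * indicator {0..a} t \<partial>lborel)"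
  proof -
    have "(\<integral>\<^sup>+t. ennreal (P_kernel k t) * indicator {isoS 0..isoS a} t \<partial>lborel) =
       (\<integral>\<^sup>+t. P_kernel k (isoS t) * isoS' t * indicator {0..a} t \<partial>lborel)"
      unfolding nn_integral_set_ennreal by (rule nn_integral_substitution)
         (use isoS_deriv S'_ge a continuous_on_isoS' in \<open>auto simp: set_borel_measurable_def\<close>)
    also have "\<dots> = (\<integral>\<^sup>+t. ?h t * indicator {0..a} t \<partial>lborel)"
    \<comment> \<open>At the turning point a the derivative of \<open>isoS\<close> vanishes, so the
      left side is 0 and the pointwise identity fails there; a single point is negligible.\<close>
    proof (rule nn_integral_cong_AE, rule AE_I[of _ _ "{a}"], safe)
      fix t assume ne: "ennreal (P_kernel k (isoS t) * isoS' t * indicator {0..a} t) \<noteq> ?h t * indicator {0..a} t"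
      then have t: "t \<in> {0..a}" by (rule contrapos_np) simp
      show "t = a"
      proof (rule ccontr)
        assume "t \<noteq> a"
        then have "P_kernel k (isoS t) * isoS' t = 1 / sqrt (isoD (cos t))"
          using P_kernel_isoS[OF N_nz[of t]] S'_ge[OF t] t a by simp
        then show False using ne t by simp
      qed
    qed auto
    finally show ?thesis by (simp add: S_0 s_def)
  qed
  have P_kernel_even: "P_kernel k (- t) = P_kernel k t" for t
    by (simp add: P_kernel_def P_disc_def)
  have 2: "(\<integral>\<^sup>+t. ennreal (P_kernel k t) * indicator {0..s} t \<partial>lborel) = (\<integral>\<^sup>+t. ?h t * indicator {a..pi} t \<partial>lborel)"
  proof -
    \<comment> \<open>The substitution rule wants a nondecreasing map, so the descending branch is
      negated and the evenness of the kernel absorbs the sign.\<close>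
    have "(\<integral>\<^sup>+t. ennreal (P_kernel k t) * indicator {0..s} t \<partial>lborel) = (\<integral>\<^sup>+t. ennreal (P_kernel k t) * indicator {- isoS a..- isoS pi} t \<partial>lborel)"
      by (subst nn_integral_real_affine[where c = "-1" and t = 0])
         (auto simp: P_kernel_even s_def S_pi indicator_def intro!: nn_integral_cong)
    also have "\<dots> = (\<integral>\<^sup>+t. P_kernel k (- isoS t) * (- isoS' t) * indicator {a..pi} t \<partial>lborel)"
      unfolding nn_integral_set_ennreal by (rule nn_integral_substitution)
         (use isoS_deriv S'_le a in \<open>auto simp: set_borel_measurable_def intro!: derivative_eq_intros continuous_intros continuous_on_isoS'\<close>)
    also have "\<dots> = (\<integral>\<^sup>+t. ?h t * indicator {a..pi} t \<partial>lborel)"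
    proof (rule nn_integral_cong_AE, rule AE_I[of _ _ "{a}"], safe)
      fix t assume ne: "ennreal (P_kernel k (- isoS t) * (- isoS' t) * indicator {a..pi} t) \<noteq> ?h t * indicator {a..pi} t"
      then have t: "t \<in> {a..pi}" by (rule contrapos_np) simp
      show "t = a"
      proof (rule ccontr)
        assume "t \<noteq> a"
        then have "P_kernel k (isoS t) * - isoS' t = 1 / sqrt (isoD (cos t))"
          using P_kernel_isoS[OF N_nz[of t]] S'_le[OF t] t a by simp
        then show False using ne t by (simp add: P_kernel_even)
      qed
    qed auto
    finally show ?thesis .
  qed
  have cos_s: "2 + 2 * cos s = \<tau>"
  proof -
    \<comment> \<open>The quadratic T^2 - (c + 2) T + 1 governs both the turning point and the sign
      of \<open>P_disc\<close>, so the highest value of \<open>isoS\<close> is exactly the edge of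
      the support of \<open>P_kernel\<close>.\<close>
    have "isoM (- \<tau>) - \<tau> * isoD (- \<tau>) = - (\<tau>^2 - (c + 2) * \<tau> + 1) * (4 * \<tau> - 1)"
      by (simp add: isoM_def isoD_def power2_eq_square algebra_simps)
    then have "isoM (- \<tau>) = \<tau> * isoD (- \<tau>)"
      using \<tau>(3) by simp
    then show ?thesis
      using isoD_pos[of "-\<tau>"] unfolding s_def cos_isoS cos_a by simp
  qed
  have P_kernel_zero: "P_kernel k t = 0" if "t \<in> {s<..pi}" for t
  proof -
    let ?T = "2 + 2 * cos t"
    have "cos t < cos s" using that s by (intro cos_monotone_0_pi) auto
    then have lt: "?T < \<tau>" using cos_s by simp
    have "P_disc k t = - 4 * (?T^2 - (c + 2) * ?T + 1)"
      unfolding P_disc_def c by (simp add: power2_eq_square algebra_simps)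
    also have "?T^2 - (c + 2) * ?T + 1 = (?T - \<tau>) * (?T - 1 / \<tau>)"
      unfolding c_\<tau> using \<tau>(1) by (simp add: algebra_simps add_divide_distrib diff_divide_distrib power2_eq_square)
    finally have "P_disc k t = - 4 * ((?T - \<tau>) * (?T - 1 / \<tau>))" .
    moreover have "(?T - \<tau>) * (?T - 1 / \<tau>) > 0"
      using lt \<tau>(2) inv\<tau> by (intro mult_neg_neg) linarith+
    ultimately have "P_disc k t < 0" by linarith
    then show ?thesis by (simp add: P_kernel_def)
  qed
  have P_kernel_cut: "(\<integral>\<^sup>+t. ennreal (P_kernel k t) * indicator {0..pi} t \<partial>lborel) = (\<integral>\<^sup>+t. ennreal (P_kernel k t) * indicator {0..s} t \<partial>lborel)"
    using s P_kernel_zero by (intro nn_integral_cong) (auto simp: indicator_def)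
  have cP: "(\<integral>\<^sup>+t. P_kernel k t \<partial>circ) = 2 * (\<integral>\<^sup>+t. ennreal (P_kernel k t) * indicator {0..pi} t \<partial>lborel)"
    by (rule nn_integral_circ_even) (measurable, simp add: P_kernel_def P_disc_def)
  have cR: "(\<integral>\<^sup>+t. R_kernel k t \<partial>circ) = 2 * (\<integral>\<^sup>+t. ennreal (R_kernel k t) * indicator {0..pi} t \<partial>lborel)"
    by (rule nn_integral_circ_even) (measurable, simp add: R_kernel_def R_disc_def)
  have hR: "?h t = 2 * ennreal (R_kernel k t)" for t
  proof -
    have "2 * ennreal (R_kernel k t) = ennreal (2 * R_kernel k t)"
      by (simp add: ennreal_mult')
    also have "2 * R_kernel k t = 1 / sqrt (isoD (cos t))"
      unfolding R_kernel_def R_disc_def isoD_def unfolding c by (simp add: add.commute add_diff_eq)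
    finally show ?thesis by simp
  qed
  have "(\<integral>\<^sup>+t. P_kernel k t \<partial>circ) = (\<integral>\<^sup>+t. ?h t * indicator {0..a} t \<partial>lborel) + (\<integral>\<^sup>+t. ?h t * indicator {a..pi} t \<partial>lborel)"
    unfolding cP P_kernel_cut 1[symmetric] 2[symmetric] by (rule mult_2)
  also have "\<dots> = (\<integral>\<^sup>+t. ?h t * indicator {0..pi} t \<partial>lborel)"
    using a by (intro nn_integral_split_Icc[symmetric]) auto
  also have "\<dots> = (\<integral>\<^sup>+t. 2 * (ennreal (R_kernel k t) * indicator {0..pi} t) \<partial>lborel)"
    unfolding hR by (simp add: mult.assoc)
  also have "\<dots> = (\<integral>\<^sup>+t. R_kernel k t \<partial>circ)"
    unfolding cR by (rule nn_integral_cmult) auto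
  finally show ?thesis .
qed

end

section \<open>Integration over the parameter\<close>

text \<open>
  By Jensen's formula, these are the averages over the remaining variable of \<open>ln |P|\<close> and \<open>ln |R|\<close>.
  The maximum covers the case of a conjugate pair of roots on the unit circle.
\<close>
definition P_inner :: "real \<Rightarrow> real \<Rightarrow> real" where
  "P_inner k t = ln ((max (k * sqrt (2 + 2 * cos t)) (2 * \<bar>1 + 2 * cos t\<bar>) + sqrt (max 0 (P_disc k t))) / 2)"

definition R_inner :: "real \<Rightarrow> real \<Rightarrow> real" where
  "R_inner k t = ln (k / 2 + sqrt (R_disc k t))"

lemma measurable_P_inner [measurable]: "P_inner k \<in> borel_measurable borel"
  unfolding P_inner_def P_disc_def by measurable

lemma measurable_R_inner [measurable]: "R_inner k \<in> borel_measurable borel"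
  unfolding R_inner_def R_disc_def by measurable

lemma P_inner_arg_pos:
  assumes "k > 0"
  shows "max (k * sqrt (2 + 2 * cos t)) (2 * \<bar>1 + 2 * cos t\<bar>) + sqrt (max 0 (P_disc k t)) > 0"
proof -
  have "max (k * sqrt (2 + 2 * cos t)) (2 * \<bar>1 + 2 * cos t\<bar>) > 0"
  proof (cases "1 + 2 * cos t = 0")
    case True
    then show ?thesis using assms by (simp add: less_max_iff_disj)
  qed (simp add: less_max_iff_disj)
  then show ?thesis by (simp add: add_pos_nonneg)
qed

section \<open>Increments in k as integrals of the kernels\<close>

lemma P_disc_pos_iff:
  assumes "k > 0"
  shows "P_disc k t > 0 \<longleftrightarrow> 2 * \<bar>1 + 2 * cos t\<bar> < k * sqrt (2 + 2 * cos t)"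
proof -
  define a b where "a = 2 * \<bar>1 + 2 * cos t\<bar>" and "b = k * sqrt (2 + 2 * cos t)"
  have "P_disc k t = b^2 - a^2"
    using two_plus_two_cos_nonneg[of t] by (simp add: P_disc_def a_def b_def power_mult_distrib)
  moreover have "0 \<le> a" "0 \<le> b"
    using assms two_plus_two_cos_nonneg[of t] by (auto simp: a_def b_def)
  ultimately show ?thesis
    using power_strict_mono[of a b 2] power2_less_imp_less[of a b]
    unfolding a_def[symmetric] b_def[symmetric] by auto
qed

text \<open>If the discriminant is positive, \<open>P_inner\<close> is an inverse hyperbolic cosine
  in k up to a constant. If it is negative, \<open>P_inner\<close> equals ln |1 + 2 cos t| near k
  and does not depend on k.\<close>

lemma P_inner_deriv:
  assumes k: "k > 0" and nz: "P_disc k t \<noteq> 0"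
  shows "((\<lambda>k. P_inner k t) has_real_derivative P_kernel k t) (at k)"
proof (cases "P_disc k t > 0")
  case True
  let ?T = "sqrt (2 + 2 * cos t)"
  have "open {k. k > 0 \<and> P_disc k t > 0}"
    unfolding P_disc_def by (intro open_Collect_conj open_Collect_less continuous_intros)
  then have ev: "\<forall>\<^sub>F x in nhds k. x \<in> {k. k > 0 \<and> P_disc k t > 0}"
    using True k by (intro eventually_nhds_in_open) auto
  have eq: "\<forall>\<^sub>F x in nhds k. P_inner x t = ln ((x * ?T + sqrt (P_disc x t)) / 2)"
    using ev by eventually_elim (use P_disc_pos_iff in \<open>auto simp: P_inner_def max_def\<close>)
  have kT: "k * ?T > 0"
    using P_disc_pos_iff[OF k, of t] True by (smt (verit) abs_ge_zero)
  have "((\<lambda>x. P_disc x t) has_real_derivative 2 * k * (2 + 2 * cos t)) (at k)"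
    unfolding P_disc_def by (auto intro!: derivative_eq_intros)
  from DERIV_chain2[OF DERIV_real_sqrt[OF True] this]
  have sq: "((\<lambda>x. sqrt (P_disc x t)) has_real_derivative inverse (sqrt (P_disc k t)) / 2 * (2 * k * (2 + 2 * cos t))) (at k)" .
  have arg: "(k * ?T + sqrt (P_disc k t)) / 2 > 0"
    using kT True by (simp add: add_pos_nonneg)
  have "((\<lambda>x. (x * ?T + sqrt (P_disc x t)) / 2) has_real_derivative
      (?T + inverse (sqrt (P_disc k t)) / 2 * (2 * k * (2 + 2 * cos t))) / 2) (at k)"
    by (intro DERIV_cdivide DERIV_add sq) (auto intro!: derivative_eq_intros)
  from DERIV_chain2[OF DERIV_ln[OF arg] this]
  have "((\<lambda>x. ln ((x * ?T + sqrt (P_disc x t)) / 2)) has_real_derivative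
     inverse ((k * ?T + sqrt (P_disc k t)) / 2) *
      ((?T + inverse (sqrt (P_disc k t)) / 2 * (2 * k * (2 + 2 * cos t))) / 2)) (at k)" .
  moreover have "inverse ((k * ?T + sqrt (P_disc k t)) / 2) *
      ((?T + inverse (sqrt (P_disc k t)) / 2 * (2 * k * (2 + 2 * cos t))) / 2) = P_kernel k t"
  proof -
    define r where "r = sqrt (P_disc k t)"
    define q where "q = ?T"
    have r: "r > 0" using True by (simp add: r_def)
    have qq: "2 + 2 * cos t = q * q" using two_plus_two_cos_nonneg[of t] by (simp add: q_def)
    have "(q + inverse r / 2 * (2 * k * (q * q))) / 2 = (k * q + r) / 2 * (q / r)"
      using r by (simp add: field_simps)
    moreover have "(k * q + r) / 2 \<noteq> 0"
      using arg unfolding q_def[symmetric] r_def[symmetric] by simp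
    ultimately have "inverse ((k * q + r) / 2) * ((q + inverse r / 2 * (2 * k * (q * q))) / 2) = q / r"
      by (simp del: mult_eq_0_iff divide_eq_0_iff)
    moreover have "P_kernel k t = q / r"
      using True by (simp add: P_kernel_def q_def r_def)
    ultimately show ?thesis
      unfolding r_def[symmetric] q_def[symmetric] unfolding qq by (simp only:)
  qed
  ultimately show ?thesis
    using DERIV_cong_ev[OF refl eq refl] by metis
next
  case False
  with nz have neg: "P_disc k t < 0" by simp
  have "open {k. k > 0 \<and> P_disc k t < 0}"
    unfolding P_disc_def by (intro open_Collect_conj open_Collect_less continuous_intros)
  then have ev: "\<forall>\<^sub>F x in nhds k. x \<in> {k. k > 0 \<and> P_disc k t < 0}"
    using neg k by (intro eventually_nhds_in_open) auto
  have eq: "\<forall>\<^sub>F x in nhds k. P_inner x t = ln ((2 * \<bar>1 + 2 * cos t\<bar> + sqrt 0) / 2)"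
    using ev
  proof eventually_elim
    case (elim x)
    then have "max (x * sqrt (2 + 2 * cos t)) (2 * \<bar>1 + 2 * cos t\<bar>) = 2 * \<bar>1 + 2 * cos t\<bar>"
      using P_disc_pos_iff[of x t] by (simp add: max_def)
    moreover have "max 0 (P_disc x t) = 0" using elim by simp
    ultimately show ?case unfolding P_inner_def by simp
  qed
  have "((\<lambda>x. ln ((2 * \<bar>1 + 2 * cos t\<bar> + sqrt 0) / 2)) has_real_derivative 0) (at k)"
    by (rule DERIV_const)
  moreover have "P_kernel k t = 0" using neg by (simp add: P_kernel_def)
  ultimately show ?thesis
    using DERIV_cong_ev[OF refl eq refl] by metis
qed

lemma continuous_on_P_inner:
  assumes "a > 0"
  shows "continuous_on {a..b} (\<lambda>k. P_inner k t)"
proof -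
  have "continuous_on {a..b} (\<lambda>k. (max (k * sqrt (2 + 2 * cos t)) (2 * \<bar>1 + 2 * cos t\<bar>) + sqrt (max 0 (P_disc k t))) / 2)"
    unfolding P_disc_def by (intro continuous_intros) simp
  then show ?thesis
    unfolding P_inner_def
  proof (rule continuous_on_ln)
    show "\<forall>k\<in>{a..b}. (max (k * sqrt (2 + 2 * cos t)) (2 * \<bar>1 + 2 * cos t\<bar>) + sqrt (max 0 (P_disc k t))) / 2 \<noteq> 0"
    proof
      fix k assume "k \<in> {a..b}"
      then show "(max (k * sqrt (2 + 2 * cos t)) (2 * \<bar>1 + 2 * cos t\<bar>) + sqrt (max 0 (P_disc k t))) / 2 \<noteq> 0"
        using half_gt_zero[OF P_inner_arg_pos[of k t]] assms by (metis atLeastAtMost_iff less_irrefl less_le_trans)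
    qed
  qed
qed

text \<open>For a fixed t, the derivative in k can fail at one positive k at most, which suits the
  fundamental theorem of calculus with a finite exceptional set.\<close>

lemma finite_P_disc_zeros: "finite {k \<in> {0<..}. P_disc k t = 0}"
proof (cases "2 + 2 * cos t = 0")
  case True
  then have "cos t = -1" by linarith
  then have "{k \<in> {0<..}. P_disc k t = 0} = {}" by (auto simp: P_disc_def)
  then show ?thesis by (metis finite.emptyI)
next
  case False
  then have pos: "2 + 2 * cos t > 0" using two_plus_two_cos_nonneg[of t] by linarith
  have "{k \<in> {0<..}. P_disc k t = 0} \<subseteq> {sqrt (4 * (1 + 2 * cos t)^2 / (2 + 2 * cos t))}"
  proof safe
    fix k :: real assume "k > 0" "P_disc k t = 0"
    then have "k^2 = 4 * (1 + 2 * cos t)^2 / (2 + 2 * cos t)"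
      using pos unfolding P_disc_def by (simp only: eq_divide_eq) simp
    then show "k = sqrt (4 * (1 + 2 * cos t)^2 / (2 + 2 * cos t))"
      using \<open>k > 0\<close> by (metis real_sqrt_unique less_imp_le)
  qed
  then show ?thesis by (rule finite_subset) simp
qed

text \<open>The kernel may blow up at the exceptional k, but \<open>P_inner\<close> stays continuous
  there. Nonnegativity turns the resulting gauge integral into a Lebesgue integral.\<close>

lemma nn_integral_P_kernel_parameter:
  assumes "0 < k" "k \<le> K"
  shows "(\<integral>\<^sup>+x. ennreal (P_kernel x t) * indicator {k..K} x \<partial>lborel) = ennreal (P_inner K t - P_inner k t)"
proof (rule nn_integral_has_integral_lebesgue')
  show "((\<lambda>x. P_kernel x t) has_integral P_inner K t - P_inner k t) {k..K}"
  proof (rule fundamental_theorem_of_calculus_interior_strong[OF finite_P_disc_zeros assms(2)])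
    fix x assume "x \<in> {k<..<K} - {k \<in> {0<..}. P_disc k t = 0}"
    then have "x > 0" "P_disc x t \<noteq> 0" using assms by auto
    from P_inner_deriv[OF this] show "((\<lambda>k. P_inner k t) has_vector_derivative P_kernel x t) (at x)"
      by (simp add: has_real_derivative_iff_has_vector_derivative)
  qed (rule continuous_on_P_inner[OF assms(1)])
qed (rule P_kernel_nonneg)

lemma R_inner_deriv:
  assumes k: "k > 3"
  shows "((\<lambda>k. R_inner k t) has_real_derivative R_kernel k t) (at k)"
proof -
  note pos = R_disc_pos[OF k, of t]
  have "((\<lambda>x. R_disc x t) has_real_derivative k / 2) (at k)"
    unfolding R_disc_def by (auto intro!: derivative_eq_intros)
  from DERIV_chain2[OF DERIV_real_sqrt[OF pos] this]
  have sq: "((\<lambda>x. sqrt (R_disc x t)) has_real_derivative inverse (sqrt (R_disc k t)) / 2 * (k / 2)) (at k)" .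
  have arg: "k / 2 + sqrt (R_disc k t) > 0"
    using k pos by (simp add: add_pos_pos)
  have "((\<lambda>x. x / 2 + sqrt (R_disc x t)) has_real_derivative
      1 / 2 + inverse (sqrt (R_disc k t)) / 2 * (k / 2)) (at k)"
    by (intro DERIV_add sq DERIV_cdivide DERIV_ident)
  from DERIV_chain2[OF DERIV_ln[OF arg] this]
  have "((\<lambda>x. R_inner x t) has_real_derivative
     inverse (k / 2 + sqrt (R_disc k t)) * (1 / 2 + inverse (sqrt (R_disc k t)) / 2 * (k / 2))) (at k)"
    unfolding R_inner_def .
  moreover have "inverse (k / 2 + sqrt (R_disc k t)) * (1 / 2 + inverse (sqrt (R_disc k t)) / 2 * (k / 2)) = R_kernel k t"
  proof -
    define r where "r = sqrt (R_disc k t)"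
    have r: "r > 0" using pos by (simp add: r_def)
    have "1 / 2 + inverse r / 2 * (k / 2) = (k / 2 + r) * (1 / (2 * r))"
      using r by (simp add: field_simps)
    moreover have "k / 2 + r \<noteq> 0" using r k by simp
    ultimately have "inverse (k / 2 + r) * (1 / 2 + inverse r / 2 * (k / 2)) = 1 / (2 * r)"
      by simp
    then show ?thesis by (simp add: R_kernel_def r_def)
  qed
  ultimately show ?thesis by simp
qed

lemma R_kernel_nonneg: "k > 3 \<Longrightarrow> 0 \<le> R_kernel k t"
  using R_disc_pos[of k t] by (simp add: R_kernel_def)

lemma nn_integral_R_kernel_parameter:
  assumes "3 < k" "k \<le> K"
  shows "(\<integral>\<^sup>+x. ennreal (R_kernel x t) * indicator {k..K} x \<partial>lborel) = ennreal (R_inner K t - R_inner k t)"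
proof (rule nn_integral_has_integral_lebesgue')
  show "((\<lambda>x. R_kernel x t) has_integral R_inner K t - R_inner k t) {k..K}"
  proof (rule fundamental_theorem_of_calculus[OF assms(2)])
    fix x assume "x \<in> {k..K}"
    then have "x > 3" using assms by auto
    from R_inner_deriv[OF this] show "((\<lambda>k. R_inner k t) has_vector_derivative R_kernel x t) (at x within {k..K})"
      by (simp add: has_real_derivative_iff_has_vector_derivative has_vector_derivative_at_within)
  qed
qed (use R_kernel_nonneg assms in auto)

lemma P_inner_mono: "0 < k \<Longrightarrow> k \<le> K \<Longrightarrow> P_inner k t \<le> P_inner K t"
proof -
  assume k: "0 < k" "k \<le> K"
  have "P_disc k t \<le> P_disc K t"
    unfolding P_disc_def using k two_plus_two_cos_nonneg[of t] by (intro diff_right_mono mult_right_mono power_mono) auto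
  then show ?thesis
    unfolding P_inner_def using k two_plus_two_cos_nonneg[of t] P_inner_arg_pos[OF k(1), of t]
    by (intro ln_mono divide_right_mono add_mono max.mono mult_right_mono real_sqrt_le_mono) auto
qed

lemma R_inner_mono: "3 < k \<Longrightarrow> k \<le> K \<Longrightarrow> R_inner k t \<le> R_inner K t"
proof -
  assume k: "3 < k" "k \<le> K"
  have "R_disc k t \<le> R_disc K t"
    unfolding R_disc_def using k by (intro add_left_mono divide_right_mono power_mono) auto
  then show ?thesis
    unfolding R_inner_def using k R_disc_pos[OF k(1), of t]
    by (intro ln_mono add_mono divide_right_mono real_sqrt_le_mono) (auto intro: add_pos_pos)
qed

lemma nn_integral_increment_eq:
  assumes "3 < k" "k \<le> K"
  shows "(\<integral>\<^sup>+t. ennreal (P_inner K t - P_inner k t) \<partial>circ) = (\<integral>\<^sup>+t. ennreal (R_inner K t - R_inner k t) \<partial>circ)"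
proof -
  have "(\<integral>\<^sup>+t. ennreal (P_inner K t - P_inner k t) \<partial>circ) =
     (\<integral>\<^sup>+t. \<integral>\<^sup>+x. ennreal (P_kernel x t) * indicator {k..K} x \<partial>lborel \<partial>circ)"
    using assms by (simp add: nn_integral_P_kernel_parameter)
  also have "\<dots> = (\<integral>\<^sup>+x. \<integral>\<^sup>+t. ennreal (P_kernel x t) * indicator {k..K} x \<partial>circ \<partial>lborel)"
    by (rule circ_lborel.Fubini'[symmetric]) (measurable)
  also have "\<dots> = (\<integral>\<^sup>+x. \<integral>\<^sup>+t. ennreal (R_kernel x t) * indicator {k..K} x \<partial>circ \<partial>lborel)"
  proof (rule nn_integral_cong)
    fix x :: real
    show "(\<integral>\<^sup>+t. ennreal (P_kernel x t) * indicator {k..K} x \<partial>circ) = (\<integral>\<^sup>+t. ennreal (R_kernel x t) * indicator {k..K} x \<partial>circ)"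
      using period_identity[OF _ refl, of x] assms by (cases "x \<in> {k..K}") (auto simp: nn_integral_multc)
  qed
  also have "\<dots> = (\<integral>\<^sup>+t. \<integral>\<^sup>+x. ennreal (R_kernel x t) * indicator {k..K} x \<partial>lborel \<partial>circ)"
    by (rule circ_lborel.Fubini') (measurable)
  also have "\<dots> = (\<integral>\<^sup>+t. ennreal (R_inner K t - R_inner k t) \<partial>circ)"
    using assms by (simp add: nn_integral_R_kernel_parameter)
  finally show ?thesis .
qed

section \<open>Behaviour as k tends to infinity\<close>

definition P_scaled :: "real \<Rightarrow> real \<Rightarrow> real" where
  "P_scaled e t = (max (sqrt (2 + 2 * cos t)) (2 * \<bar>1 + 2 * cos t\<bar> * e)
     + sqrt (max 0 (2 + 2 * cos t - 4 * (1 + 2 * cos t)^2 * e^2))) / 2"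

definition R_scaled :: "real \<Rightarrow> real \<Rightarrow> real" where
  "R_scaled e t = 1 / 2 + sqrt (1 / 4 + (4 * (cos t)^2 + 2 * cos t - 2) * e^2)"

text \<open>Splitting off ln k and putting e = 1 / k moves the limit to e = 0, where the scaled
  functions are continuous, with values |1 + x| for \<open>P\<close> and 1 for
  \<open>R\<close>.\<close>

lemma P_inner_eq_P_scaled:
  assumes "k > 0"
  shows "P_inner k t = ln k + ln (P_scaled (1 / k) t)"
proof -
  have 1: "max (k * sqrt (2 + 2 * cos t)) (2 * \<bar>1 + 2 * cos t\<bar>) =
      k * max (sqrt (2 + 2 * cos t)) (2 * \<bar>1 + 2 * cos t\<bar> * (1 / k))"
    using assms by (simp add: max_mult_distrib_left)
  have "P_disc k t = k^2 * (2 + 2 * cos t - 4 * (1 + 2 * cos t)^2 * (1 / k)^2)"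
    using assms by (simp add: P_disc_def right_diff_distrib power_divide)
  then have "max 0 (P_disc k t) = k^2 * max 0 (2 + 2 * cos t - 4 * (1 + 2 * cos t)^2 * (1 / k)^2)"
    by (simp only: max_mult_distrib_left) simp
  then have 2: "sqrt (max 0 (P_disc k t)) = k * sqrt (max 0 (2 + 2 * cos t - 4 * (1 + 2 * cos t)^2 * (1 / k)^2))"
    using assms by (simp add: real_sqrt_mult)
  have e: "(max (k * sqrt (2 + 2 * cos t)) (2 * \<bar>1 + 2 * cos t\<bar>) + sqrt (max 0 (P_disc k t))) / 2 = k * P_scaled (1 / k) t"
    unfolding 1 2 P_scaled_def by (simp add: algebra_simps)
  have "k * P_scaled (1 / k) t > 0"
    unfolding e[symmetric] by (rule half_gt_zero[OF P_inner_arg_pos[OF assms]])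
  then have "P_scaled (1 / k) t > 0" using assms by (simp add: zero_less_mult_iff)
  then show ?thesis
    unfolding P_inner_def e using assms by (simp add: ln_mult)
qed

lemma R_inner_eq_R_scaled:
  assumes "k > 3"
  shows "R_inner k t = ln k + ln (R_scaled (1 / k) t)"
proof -
  have "R_disc k t = k^2 * (1 / 4 + (4 * (cos t)^2 + 2 * cos t - 2) * (1 / k)^2)"
    using assms by (simp add: R_disc_def field_simps)
  then have "sqrt (R_disc k t) = k * sqrt (1 / 4 + (4 * (cos t)^2 + 2 * cos t - 2) * (1 / k)^2)"
    using assms by (simp add: real_sqrt_mult)
  then have e: "k / 2 + sqrt (R_disc k t) = k * R_scaled (1 / k) t"
    unfolding R_scaled_def by (simp add: algebra_simps)
  have "k / 2 + sqrt (R_disc k t) > 0" using assms R_disc_pos[OF assms, of t] by (simp add: add_pos_pos)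
  then have "R_scaled (1 / k) t > 0" unfolding e using assms by (simp add: zero_less_mult_iff)
  then show ?thesis
    unfolding R_inner_def e using assms by (simp add: ln_mult)
qed

lemma cmod_one_plus_cis: "cmod (1 + cis t) = sqrt (2 + 2 * cos t)"
proof -
  have "(1 + cos t)^2 + (sin t)^2 = 2 + 2 * cos t"
    unfolding sin_squared_eq by (simp add: power2_eq_square algebra_simps)
  then show ?thesis by (simp add: cmod_def)
qed

text \<open>A dominating function independent of e: the scaled function lies between |1 + x| / 2 and
  6, and ln |1 + x| is integrable by the boundary case of Jensen's formula.\<close>

lemma ln_P_scaled_bound:
  assumes "0 \<le> e" "e \<le> 1" and nz: "1 + cis t \<noteq> 0"
  shows "\<bar>ln (P_scaled e t)\<bar> \<le> ln 2 + ln 6 + \<bar>ln (cmod (1 + cis t))\<bar>"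
proof -
  define q where "q = cmod (1 + cis t)"
  have q: "q > 0" using nz by (simp add: q_def)
  have qs: "sqrt (2 + 2 * cos t) = q" by (simp add: q_def cmod_one_plus_cis)
  have q2: "q \<le> 2" unfolding q_def using norm_triangle_ineq[of 1 "cis t"] by simp
  have lo: "q / 2 \<le> P_scaled e t"
    unfolding P_scaled_def qs by (intro divide_right_mono add_increasing2) auto
  have "sqrt (max 0 (2 + 2 * cos t - 4 * (1 + 2 * cos t)^2 * e^2)) \<le> q"
    unfolding qs[symmetric] using two_plus_two_cos_nonneg[of t] by (intro real_sqrt_le_mono) auto
  moreover have a3: "\<bar>1 + 2 * cos t\<bar> \<le> 3"
    unfolding abs_le_iff using cos_le_one[of t] cos_ge_minus_one[of t] by linarith
  have "2 * \<bar>1 + 2 * cos t\<bar> * e \<le> 6 * 1"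
    using a3 assms(1,2) by (intro mult_mono) auto
  then have "max q (2 * \<bar>1 + 2 * cos t\<bar> * e) \<le> 6"
    using q2 by (intro max.boundedI) auto
  ultimately have "P_scaled e t \<le> (6 + q) / 2"
    unfolding P_scaled_def qs by (intro divide_right_mono add_mono) auto
  then have hi: "P_scaled e t \<le> 6" using q2 by simp
  have "ln (q / 2) \<le> ln (P_scaled e t)" "ln (P_scaled e t) \<le> ln 6"
    using lo hi q by (auto intro!: ln_mono)
  moreover have "ln (q / 2) = ln q - ln 2" using q by (simp add: ln_div)
  moreover have "(ln 2 :: real) \<ge> 0" "(ln 6 :: real) \<ge> 0" by auto
  ultimately show ?thesis unfolding q_def[symmetric] by linarith
qed

text \<open>The minimum of 4 C^2 + 2 C - 2 is -9/4, so e = 1/3 is precisely where the radicand can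
  first reach 0.\<close>

lemma ln_R_scaled_bound:
  assumes "0 \<le> e" "e \<le> 1 / 3"
  shows "R_scaled e t > 0" "\<bar>ln (R_scaled e t)\<bar> \<le> ln 2"
proof -
  have e2: "e^2 \<le> 1 / 9" using power_mono[OF assms(2,1), of 2] by (simp add: power2_eq_square)
  let ?d = "4 * (cos t)^2 + 2 * cos t - 2"
  have dlo: "?d \<ge> - 9 / 4"
  proof -
    have "?d + 9 / 4 = (2 * cos t + 1 / 2)^2" by (simp add: power2_eq_square algebra_simps)
    then show ?thesis using zero_le_power2[of "2 * cos t + 1 / 2"] by linarith
  qed
  have "(cos t)^2 \<le> 1" by (simp add: abs_square_le_1)
  then have dhi: "?d \<le> 4"
    using cos_le_one[of t] by linarith
  have "?d * e^2 \<ge> - 9 / 4 * e^2" "?d * e^2 \<le> 4 * e^2"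
    using dlo dhi by (intro mult_right_mono; simp)+
  then have "0 \<le> 1 / 4 + ?d * e^2" "1 / 4 + ?d * e^2 \<le> 1"
    using e2 by auto
  then have "0 \<le> sqrt (1 / 4 + ?d * e^2)" "sqrt (1 / 4 + ?d * e^2) \<le> 1"
    by auto
  then have b: "1 / 2 \<le> R_scaled e t" "R_scaled e t \<le> 2" unfolding R_scaled_def by linarith+
  then show "R_scaled e t > 0" by simp
  have "ln (1 / 2) \<le> ln (R_scaled e t)" "ln (R_scaled e t) \<le> ln 2" using b by (auto intro!: ln_mono)
  then show "\<bar>ln (R_scaled e t)\<bar> \<le> ln 2" by (simp add: ln_div)
qed

lemma ln_one_plus_cis:
  "integrable circ (\<lambda>t. ln (cmod (1 + cis t)))" "(\<integral>t. ln (cmod (1 + cis t)) \<partial>circ) = 0"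
  using circ_log_abs_bound(1)[of 1] circ_log_zero[of 1] by simp_all

lemma AE_one_plus_cis: "AE t in circ. 1 + cis t \<noteq> 0"
  using AE_one_plus_cis_nonzero[of 1] by simp

lemma integrable_P_inner:
  assumes "k \<ge> 1"
  shows "integrable circ (P_inner k)"
proof (rule Bochner_Integration.integrable_bound)
  show "integrable circ (\<lambda>t. ln k + (ln 2 + ln 6 + \<bar>ln (cmod (1 + cis t))\<bar>))"
    using ln_one_plus_cis(1) by auto
  show "AE t in circ. norm (P_inner k t) \<le> norm (ln k + (ln 2 + ln 6 + \<bar>ln (cmod (1 + cis t))\<bar>))"
    using AE_one_plus_cis
  proof eventually_elim
    case (elim t)
    have "ln k \<ge> 0" using assms by simp
    moreover have "\<bar>ln (P_scaled (1 / k) t)\<bar> \<le> ln 2 + ln 6 + \<bar>ln (cmod (1 + cis t))\<bar>"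
      using assms elim by (intro ln_P_scaled_bound) auto
    ultimately show ?case
      using P_inner_eq_P_scaled[of k t] assms unfolding real_norm_def by linarith
  qed
qed simp

lemma integrable_R_inner:
  assumes "k > 3"
  shows "integrable circ (R_inner k)"
proof (rule circ.integrable_const_bound[where B = "ln k + ln 2"])
  show "AE t in circ. norm (R_inner k t) \<le> ln k + ln 2"
  proof (rule AE_I2)
    fix t
    have "\<bar>ln (R_scaled (1 / k) t)\<bar> \<le> ln 2"
      using assms by (intro ln_R_scaled_bound) (auto simp: field_simps)
    moreover have "ln k \<ge> 0" using assms by simp
    ultimately show "norm (R_inner k t) \<le> ln k + ln 2"
      using R_inner_eq_R_scaled[OF assms, of t] by simp
  qed
qed simp

lemma integral_increment_eq:
  assumes "3 < k" "k \<le> K"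
  shows "(\<integral>t. P_inner K t \<partial>circ) - (\<integral>t. P_inner k t \<partial>circ) = (\<integral>t. R_inner K t \<partial>circ) - (\<integral>t. R_inner k t \<partial>circ)"
proof -
  have "(\<integral>t. P_inner K t \<partial>circ) - (\<integral>t. P_inner k t \<partial>circ) = (\<integral>t. P_inner K t - P_inner k t \<partial>circ)"
    using assms integrable_P_inner[of k] integrable_P_inner[of K] by simp
  also have "\<dots> = enn2real (\<integral>\<^sup>+t. ennreal (P_inner K t - P_inner k t) \<partial>circ)"
    using assms by (intro integral_eq_nn_integral) (auto simp: P_inner_mono)
  also have "\<dots> = enn2real (\<integral>\<^sup>+t. ennreal (R_inner K t - R_inner k t) \<partial>circ)"
    using assms by (simp add: nn_integral_increment_eq)
  also have "\<dots> = (\<integral>t. R_inner K t - R_inner k t \<partial>circ)"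
    using assms by (intro integral_eq_nn_integral[symmetric]) (auto simp: R_inner_mono)
  also have "\<dots> = (\<integral>t. R_inner K t \<partial>circ) - (\<integral>t. R_inner k t \<partial>circ)"
    using assms integrable_R_inner[of k] integrable_R_inner[of K] by simp
  finally show ?thesis .
qed

text \<open>The terms ln k cancel, and by dominated convergence the limit is the integral of ln |1 +
  x|, which is 0. The offset 4 keeps k above 3.\<close>

lemma integral_diff_tendsto_0:
  "(\<lambda>n. (\<integral>t. P_inner (real n + 4) t \<partial>circ) - (\<integral>t. R_inner (real n + 4) t \<partial>circ)) \<longlonglongrightarrow> 0"
proof -
  let ?e = "\<lambda>n. 1 / (real n + 4)"
  let ?l = "\<lambda>t. ln (cmod (1 + cis t))"
  have e: "?e \<longlonglongrightarrow> 0"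
    using LIMSEQ_ignore_initial_segment[OF lim_inverse_n', of 4] by simp
  have [measurable]: "P_scaled a \<in> borel_measurable borel" "R_scaled a \<in> borel_measurable borel" for a
    unfolding P_scaled_def R_scaled_def by measurable
  have "(\<lambda>n. \<integral>t. ln (P_scaled (?e n) t) - ln (R_scaled (?e n) t) \<partial>circ) \<longlonglongrightarrow> (\<integral>t. ?l t \<partial>circ)"
  proof (rule integral_dominated_convergence)
    show "integrable circ (\<lambda>t. (ln 2 + ln 6 + \<bar>?l t\<bar>) + ln 2)"
      using ln_one_plus_cis(1) by auto
    show "AE t in circ. (\<lambda>n. ln (P_scaled (?e n) t) - ln (R_scaled (?e n) t)) \<longlonglongrightarrow> ?l t"
      using AE_one_plus_cis
    proof eventually_elim
      case (elim t)
      have T: "sqrt (2 + 2 * cos t) > 0" using elim by (simp flip: cmod_one_plus_cis)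
      have P_scaled0: "P_scaled 0 t = cmod (1 + cis t)"
        unfolding P_scaled_def cmod_one_plus_cis using two_plus_two_cos_nonneg[of t] T by (simp add: max_def)
      have R_scaled0: "R_scaled 0 t = 1"
        unfolding R_scaled_def by (simp add: real_sqrt_divide)
      have "continuous_on UNIV (\<lambda>a. P_scaled a t)" "continuous_on UNIV (\<lambda>a. R_scaled a t)"
        unfolding P_scaled_def R_scaled_def by (intro continuous_intros; simp)+
      then have "isCont (\<lambda>a. P_scaled a t) 0" "isCont (\<lambda>a. R_scaled a t) 0"
        by (simp_all add: continuous_on_eq_continuous_at)
      then have "(\<lambda>n. P_scaled (?e n) t) \<longlonglongrightarrow> P_scaled 0 t" "(\<lambda>n. R_scaled (?e n) t) \<longlonglongrightarrow> R_scaled 0 t"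
        using e by (auto intro: isCont_tendsto_compose)
      then have "(\<lambda>n. ln (P_scaled (?e n) t) - ln (R_scaled (?e n) t)) \<longlonglongrightarrow> ln (P_scaled 0 t) - ln (R_scaled 0 t)"
        using P_scaled0 R_scaled0 elim by (intro tendsto_diff tendsto_ln) auto
      then show ?case by (simp add: P_scaled0 R_scaled0)
    qed
    show "AE t in circ. norm (ln (P_scaled (?e n) t) - ln (R_scaled (?e n) t)) \<le> (ln 2 + ln 6 + \<bar>?l t\<bar>) + ln 2" for n
      using AE_one_plus_cis
    proof eventually_elim
      case (elim t)
      have "\<bar>ln (P_scaled (?e n) t)\<bar> \<le> ln 2 + ln 6 + \<bar>?l t\<bar>"
        by (rule ln_P_scaled_bound[OF _ _ elim]) (auto simp: field_simps)
      moreover have "\<bar>ln (R_scaled (?e n) t)\<bar> \<le> ln 2"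
        by (rule ln_R_scaled_bound) (auto simp: field_simps)
      ultimately show ?case unfolding real_norm_def by linarith
    qed
  qed auto
  moreover have "(\<integral>t. ln (P_scaled (?e n) t) - ln (R_scaled (?e n) t) \<partial>circ) =
      (\<integral>t. P_inner (real n + 4) t \<partial>circ) - (\<integral>t. R_inner (real n + 4) t \<partial>circ)" for n
  proof -
    have "ln (P_scaled (?e n) t) - ln (R_scaled (?e n) t) = P_inner (real n + 4) t - R_inner (real n + 4) t" for t
      by (simp add: P_inner_eq_P_scaled R_inner_eq_R_scaled)
    then show ?thesis
      using integrable_P_inner[of "real n + 4"] integrable_R_inner[of "real n + 4"] by simp
  qed
  ultimately show ?thesis by (simp add: ln_one_plus_cis(2))
qed

text \<open>The difference of the two integrals is constant for k > 3, so it equals its limit at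
  infinity.\<close>

theorem integral_P_inner_eq_R_inner:
  assumes "k > 3"
  shows "(\<integral>t. P_inner k t \<partial>circ) = (\<integral>t. R_inner k t \<partial>circ)"
proof -
  have "\<forall>\<^sub>F n in sequentially. (\<integral>t. P_inner (real n + 4) t \<partial>circ) - (\<integral>t. R_inner (real n + 4) t \<partial>circ)
      = (\<integral>t. P_inner k t \<partial>circ) - (\<integral>t. R_inner k t \<partial>circ)"
    using eventually_ge_at_top[of "nat \<lceil>k\<rceil>"]
  proof eventually_elim
    case (elim n)
    then have "k \<le> real n + 4" by linarith
    from integral_increment_eq[OF assms this] show ?case by simp
  qed
  then have "(\<lambda>n. (\<integral>t. P_inner (real n + 4) t \<partial>circ) - (\<integral>t. R_inner (real n + 4) t \<partial>circ))
      \<longlonglongrightarrow> (\<integral>t. P_inner k t \<partial>circ) - (\<integral>t. R_inner k t \<partial>circ)"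
    by (rule tendsto_eventually)
  from LIMSEQ_unique[OF this integral_diff_tendsto_0] show ?thesis by simp
qed

section \<open>Reduction to one-dimensional integrals\<close>

lemma AE_circ_Icc: "AE t in circ. t \<in> {0..2*pi}"
  unfolding circ_def by (subst AE_density) (auto simp: indicator_def)

lemma circ_pair_eq_density:
  "circ \<Otimes>\<^sub>M circ = density lborel (indicator ({0..2*pi} \<times> {0..2*pi}))"
proof -
  have "circ \<Otimes>\<^sub>M circ = density (lborel \<Otimes>\<^sub>M lborel) (\<lambda>(x, y). indicator {0..2*pi} x * indicator {0..2*pi} y)"
    unfolding circ_def
    by (rule pair_measure_density) (auto simp: sigma_finite_lborel circ_def[symmetric] intro: circ.sigma_finite_measure_axioms)
  also have "(\<lambda>(x::real, y::real). indicator {0..2*pi} x * indicator {0..2*pi} y :: ennreal) = indicator ({0..2*pi} \<times> {0..2*pi})"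
    by (auto simp: indicator_def fun_eq_iff)
  finally show ?thesis by (simp add: lborel_prod)
qed

lemma mahler_measure2_circ:
  assumes [measurable]: "(\<lambda>p. ln (cmod (F (cis (fst p)) (cis (snd p))))) \<in> borel_measurable (borel \<Otimes>\<^sub>M borel)"
  shows "mahler_measure2 F = 1 / (2 * pi)^2 * (\<integral>p. ln (cmod (F (cis (fst p)) (cis (snd p)))) \<partial>(circ \<Otimes>\<^sub>M circ))"
proof -
  have [measurable]: "(\<lambda>p. ln (cmod (F (cis (fst p)) (cis (snd p))))) \<in> borel_measurable (borel :: (real \<times> real) measure)"
    using assms by (simp add: borel_prod)
  have m: "{0..2*pi} \<times> {0..2*pi} \<in> sets (borel :: (real \<times> real) measure)"
    by (intro borel_closed closed_Times) auto
  have "circ \<Otimes>\<^sub>M circ = density lborel (\<lambda>p. ennreal (indicator ({0..2*pi} \<times> {0..2*pi}) p))"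
    unfolding circ_pair_eq_density by (simp add: ennreal_indicator)
  then show ?thesis
    unfolding mahler_measure2_def set_lebesgue_integral_def using m by (simp add: integral_density)
qed

lemma integrable_circ_pairI:
  fixes H :: "real \<Rightarrow> real \<Rightarrow> real"
  assumes [measurable]: "(\<lambda>p. H (fst p) (snd p)) \<in> borel_measurable (borel \<Otimes>\<^sub>M borel)"
    and int: "\<And>s. integrable circ (H s)"
    and bnd: "\<And>s. (\<integral>t. \<bar>H s t\<bar> \<partial>circ) \<le> B s"
    and B: "integrable circ B"
  shows "integrable (circ \<Otimes>\<^sub>M circ) (\<lambda>p. H (fst p) (snd p))"
proof (rule circ2.Fubini_integrable)
  show "integrable circ (\<lambda>s. \<integral>t. norm (H (fst (s, t)) (snd (s, t))) \<partial>circ)"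
  proof (rule Bochner_Integration.integrable_bound[OF B])
    show "AE s in circ. norm (\<integral>t. norm (H (fst (s, t)) (snd (s, t))) \<partial>circ) \<le> norm (B s)"
    proof (rule AE_I2)
      fix s
      have "0 \<le> (\<integral>t. \<bar>H s t\<bar> \<partial>circ)" by simp
      then show "norm (\<integral>t. norm (H (fst (s, t)) (snd (s, t))) \<partial>circ) \<le> norm (B s)"
        using bnd[of s] by simp
    qed
  qed measurable
qed (use int in simp_all)

lemma circ_pair_integral_fst:
  fixes H :: "real \<Rightarrow> real \<Rightarrow> real"
  assumes "integrable (circ \<Otimes>\<^sub>M circ) (\<lambda>p. H (fst p) (snd p))"
  shows "(\<integral>p. H (fst p) (snd p) \<partial>(circ \<Otimes>\<^sub>M circ)) = (\<integral>s. \<integral>t. H s t \<partial>circ \<partial>circ)"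
  using circ2.integral_fst'[OF assms] by simp

text \<open>The substitution y = x w on the torus. Integrability is assumed in the sheared
  coordinates because Jensen's formula for \<open>R\<close> yields bounds along those fibres;
  Tonelli's theorem carries it back to \<open>H\<close>.\<close>

lemma circ_pair_shear:
  fixes H :: "real \<Rightarrow> real \<Rightarrow> real"
  assumes [measurable]: "(\<lambda>p. H (fst p) (snd p)) \<in> borel_measurable (borel \<Otimes>\<^sub>M borel)"
    and per: "\<And>s t. H s (t + 2*pi) = H s t"
    and int: "integrable (circ \<Otimes>\<^sub>M circ) (\<lambda>p. H (snd p) (snd p + fst p))"
  shows "(\<integral>p. H (fst p) (snd p) \<partial>(circ \<Otimes>\<^sub>M circ)) = (\<integral>u. \<integral>s. H s (s + u) \<partial>circ \<partial>circ)"
proof -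
  let ?H' = "\<lambda>s u. H s (s + u)"
  have sect [measurable]: "H s \<in> borel_measurable borel" for s
    using measurable_compose[OF measurable_Pair1'[of s borel borel] assms(1)] by simp
  have int': "integrable (circ \<Otimes>\<^sub>M circ) (\<lambda>p. ?H' (fst p) (snd p))"
    using circ2.integrable_product_swap[OF int] by (simp add: case_prod_unfold)
  note [measurable] = borel_measurable_integrable[OF int']
  have nn: "(\<integral>\<^sup>+t. ennreal (norm (H s t)) \<partial>circ) = (\<integral>\<^sup>+u. ennreal (norm (?H' s u)) \<partial>circ)"
    and eq: "(\<integral>t. H s t \<partial>circ) = (\<integral>u. ?H' s u \<partial>circ)" if "s \<in> {0..2*pi}" for s
  proof -
    have sh: "circle_map (\<lambda>t. t + s)" using that by (intro circle_map_shift) auto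
    show "(\<integral>\<^sup>+t. ennreal (norm (H s t)) \<partial>circ) = (\<integral>\<^sup>+u. ennreal (norm (?H' s u)) \<partial>circ)"
      using circle_map_nn_integral[OF sh, of "\<lambda>t. ennreal (norm (H s t))"] per by (simp add: add.commute)
    show "(\<integral>t. H s t \<partial>circ) = (\<integral>u. ?H' s u \<partial>circ)"
      using circle_map_integral[OF sh, of "H s"] per by (simp add: add.commute)
  qed
  have "(\<integral>\<^sup>+p. ennreal (norm (H (fst p) (snd p))) \<partial>(circ \<Otimes>\<^sub>M circ)) =
     (\<integral>\<^sup>+s. \<integral>\<^sup>+t. ennreal (norm (H s t)) \<partial>circ \<partial>circ)"
    by (subst circ.nn_integral_fst[symmetric]) auto
  also have "\<dots> = (\<integral>\<^sup>+s. \<integral>\<^sup>+u. ennreal (norm (?H' s u)) \<partial>circ \<partial>circ)"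
    by (intro nn_integral_cong_AE eventually_mono[OF AE_circ_Icc] nn)
  also have "\<dots> = (\<integral>\<^sup>+p. ennreal (norm (?H' (fst p) (snd p))) \<partial>(circ \<Otimes>\<^sub>M circ))"
    by (subst circ.nn_integral_fst[symmetric]) auto
  also have "\<dots> < \<infinity>"
    using int' by (simp add: integrable_iff_bounded)
  finally have intH: "integrable (circ \<Otimes>\<^sub>M circ) (\<lambda>p. H (fst p) (snd p))"
    by (intro integrableI_bounded) auto
  have "(\<integral>p. H (fst p) (snd p) \<partial>(circ \<Otimes>\<^sub>M circ)) = (\<integral>s. \<integral>t. H s t \<partial>circ \<partial>circ)"
    by (rule circ_pair_integral_fst[OF intH])
  also have "\<dots> = (\<integral>s. \<integral>u. ?H' s u \<partial>circ \<partial>circ)"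
    by (intro integral_cong_AE eventually_mono[OF AE_circ_Icc] eq) measurable
  also have "\<dots> = (\<integral>u. \<integral>s. ?H' s u \<partial>circ \<partial>circ)"
    using circ2.Fubini_integral[of ?H'] int' by (simp add: case_prod_unfold)
  finally show ?thesis .
qed

section \<open>Factoring real quadratics on the unit circle\<close>

lemma cmod_add_real_unit:
  assumes "cmod X = 1"
  shows "cmod (X + of_real r) = cmod (1 + of_real r * X)"
proof -
  have "(Re X)^2 + (Im X)^2 = 1"
    using assms by (simp add: cmod_def)
  then have "(Re X + r)^2 + (Im X)^2 = (1 + r * Re X)^2 + (r * Im X)^2"
    by algebra
  then show ?thesis by (simp add: cmod_def)
qed

text \<open>The quadratic is m (1 + (p/m) X) (X - q/m), and on the unit circle the last factor may
  be reflected to 1 - (q/m) X. Parametrising by m rather than by the roots also covers p =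
  0.\<close>

lemma quadratic_factor_real_roots:
  fixes p k q m :: real
  assumes m: "m \<noteq> 0" "m^2 = k * m + p * q" and X: "cmod X = 1"
  shows "cmod (of_real p * X^2 + of_real k * X - of_real q) =
    \<bar>m\<bar> * cmod (1 + of_real (p / m) * X) * cmod (1 + of_real (- q / m) * X)"
proof -
  have "k = m - p * q / m"
    using m by (simp add: field_simps power2_eq_square)
  then have k: "(of_real k :: complex) = of_real m - of_real p * of_real q / of_real m"
    by simp
  have "of_real p * X^2 + of_real k * X - of_real q =
     of_real m * (1 + of_real (p / m) * X) * (X + of_real (- q / m))"
    unfolding k using m(1) by (simp add: field_simps power2_eq_square)
  then show ?thesis
    by (simp only: norm_mult norm_of_real cmod_add_real_unit[OF X])
qed

text \<open>The roots are mutually inverse: either both real, with reflection applied to the inner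
  one, or a conjugate pair on the unit circle. The expression with maxima gives the constant of
  Jensen's formula in both cases.\<close>

lemma reciprocal_quadratic_factor:
  fixes a b :: real
  assumes nz: "a \<noteq> 0 \<or> b \<noteq> 0"
  obtains z w where "cmod z \<le> 1" "cmod w \<le> 1"
    "\<And>X. cmod X = 1 \<Longrightarrow> cmod (of_real a * X^2 + of_real b * X + of_real a) =
       (max \<bar>b\<bar> (2 * \<bar>a\<bar>) + sqrt (max 0 (b^2 - 4 * a^2))) / 2 * cmod (1 + z * X) * cmod (1 + w * X)"
proof (cases "2 * \<bar>a\<bar> \<le> \<bar>b\<bar>")
  case True
  have b: "b \<noteq> 0" using True nz by auto
  have "(2 * \<bar>a\<bar>)^2 \<le> \<bar>b\<bar>^2" using True by (intro power_mono) auto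
  then have disc: "b^2 - 4 * a^2 \<ge> 0" by (simp add: power_mult_distrib)
  define r where "r = sqrt (b^2 - 4 * a^2)"
  \<comment> \<open>The solution of m^2 = b m - a^2 of larger modulus; taking the sign of b makes
    |b| and r add up.\<close>
  define m where "m = sgn b * ((\<bar>b\<bar> + r) / 2)"
  have r: "r \<ge> 0" "r^2 = b^2 - 4 * a^2" using disc by (auto simp: r_def)
  have am: "\<bar>m\<bar> = (\<bar>b\<bar> + r) / 2" using b r by (simp add: m_def abs_mult)
  have m: "m \<noteq> 0" using am b r(1) by (smt (verit) zero_less_abs_iff half_gt_zero)
  have le: "\<bar>a\<bar> \<le> \<bar>m\<bar>" using am True r(1) by simp
  have "m^2 = b * m + a * (- a)"
  proof -
    have "m^2 = ((\<bar>b\<bar> + r) / 2)^2" using am by (metis power2_abs)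
    moreover have "b * m = \<bar>b\<bar> * ((\<bar>b\<bar> + r) / 2)" by (simp add: m_def abs_sgn)
    moreover have "\<bar>b\<bar>^2 = b^2" by simp
    ultimately show ?thesis using r(2) by (simp add: power2_eq_square field_simps)
  qed
  note quad = quadratic_factor_real_roots[OF m this]
  show ?thesis
  proof (rule that[of "of_real (a / m)" "of_real (a / m)"])
    fix X assume "cmod X = 1"
    from quad[OF this] show "cmod (of_real a * X^2 + of_real b * X + of_real a) =
       (max \<bar>b\<bar> (2 * \<bar>a\<bar>) + sqrt (max 0 (b^2 - 4 * a^2))) / 2 * cmod (1 + of_real (a / m) * X) * cmod (1 + of_real (a / m) * X)"
      using True disc by (simp add: am r_def max_def)
  qed (use le m in \<open>simp_all add: norm_divide\<close>)
next
  case False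
  then have a: "a \<noteq> 0" by auto
  have "\<bar>b\<bar>^2 \<le> (2 * \<bar>a\<bar>)^2" using False by (intro power_mono) auto
  then have disc: "4 * a^2 - b^2 \<ge> 0" by (simp add: power_mult_distrib)
  define r where "r = sqrt (4 * a^2 - b^2)"
  have r: "r^2 = 4 * a^2 - b^2" using disc by (simp add: r_def)
  \<comment> \<open>Chosen so that z + cnj z = b / a and z cnj z = 1.\<close>
  define z where "z = Complex (b / (2 * a)) (r / (2 * a))"
  have "(cmod z)^2 = (b^2 + r^2) / (4 * a^2)"
    by (simp add: z_def cmod_power2 power_divide power_mult_distrib add_divide_distrib)
  then have cz2: "(cmod z)^2 = 1" using a by (simp add: r)
  then have cz: "cmod z = 1"
    using norm_ge_zero[of z] by (simp add: power2_eq_1_iff)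
  have sum: "of_real a * (z + cnj z) = of_real b"
    using a by (simp add: z_def complex_eq_iff)
  have prod: "z * cnj z = 1"
    using cz2 by (simp only: complex_norm_square[symmetric]) simp
  have fac: "of_real a * X^2 + of_real b * X + of_real a = of_real a * (1 + z * X) * (1 + cnj z * X)" for X
  proof -
    have "of_real a * (1 + z * X) * (1 + cnj z * X) =
       of_real a * (z * cnj z) * X^2 + (of_real a * (z + cnj z)) * X + of_real a"
      by (simp add: algebra_simps power2_eq_square)
    then show ?thesis unfolding sum prod by simp
  qed
  show ?thesis
  proof (rule that[of z "cnj z"])
    fix X
    show "cmod (of_real a * X^2 + of_real b * X + of_real a) =
       (max \<bar>b\<bar> (2 * \<bar>a\<bar>) + sqrt (max 0 (b^2 - 4 * a^2))) / 2 * cmod (1 + z * X) * cmod (1 + cnj z * X)"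
      unfolding fac norm_mult using False disc by (simp add: max_def)
  qed (use cz in auto)
qed

section \<open>Jensen's formula applied to P and R\<close>

lemma sqrt_two_plus_two_cos: "sqrt (2 + 2 * cos t) = \<bar>2 * cos (t / 2)\<bar>"
proof -
  have "2 + 2 * cos t = (2 * cos (t / 2))^2"
    using cos_double_cos[of "t / 2"] by (simp add: power_mult_distrib)
  then show ?thesis by (simp only: real_sqrt_abs)
qed

lemma of_real_two_cos: "of_real (2 * cos t) = cis t + inverse (cis t)"
  by (simp add: complex_eq_iff)

text \<open>Putting y = x^(1/2) X and dividing by x^2 makes the quadratic real and palindromic. The
  rotation of the variable does not affect the integral over the circle.\<close>

lemma cmod_P_poly:
  "cmod (P_poly k (cis s) y) =
     cmod (of_real (1 + 2 * cos s) * (cis (- s / 2) * y)^2 + of_real (k * (2 * cos (s / 2))) * (cis (- s / 2) * y)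
       + of_real (1 + 2 * cos s))"
proof -
  define e where "e = cis (s / 2)"
  have e: "e \<noteq> 0" "cmod e = 1" by (auto simp: e_def)
  have x: "cis s = e^2" by (simp add: e_def power2_eq_square cis_mult)
  have ie: "cis (- s / 2) = inverse e" by (simp add: e_def)
  have "of_real (1 + 2 * cos s) = 1 + (e^2 + inverse (e^2))"
    using of_real_two_cos[of s] unfolding x by (simp only: of_real_add of_real_1)
  moreover have "of_real (k * (2 * cos (s / 2))) = of_real k * (e + inverse e)"
    using of_real_two_cos[of "s / 2"] unfolding e_def by (simp only: of_real_mult[of k])
  ultimately have "P_poly k (cis s) y = e^4 * (of_real (1 + 2 * cos s) * (cis (- s / 2) * y)^2
       + of_real (k * (2 * cos (s / 2))) * (cis (- s / 2) * y) + of_real (1 + 2 * cos s))"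
    unfolding P_poly_def x ie using e(1) by (simp only:) (simp add: field_simps power2_eq_square power4_eq_xxxx)
  then show ?thesis
    using e(2) by (simp add: norm_mult norm_power)
qed

lemma P_poly_inner:
  assumes "k \<noteq> 0"
  shows "integrable circ (\<lambda>t. ln (cmod (P_poly k (cis s) (cis t))))"
    and "(\<integral>t. ln (cmod (P_poly k (cis s) (cis t))) \<partial>circ) = 2 * pi * P_inner \<bar>k\<bar> s"
    and "(\<integral>t. \<bar>ln (cmod (P_poly k (cis s) (cis t)))\<bar> \<partial>circ) \<le> 2 * pi * \<bar>P_inner \<bar>k\<bar> s\<bar> + 8 * pi * ln 2"
proof -
  let ?a = "1 + 2 * cos s" and ?b = "k * (2 * cos (s / 2))"
  define C where "C = (max \<bar>?b\<bar> (2 * \<bar>?a\<bar>) + sqrt (max 0 (?b^2 - 4 * ?a^2))) / 2"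
  have b: "\<bar>?b\<bar> = \<bar>k\<bar> * sqrt (2 + 2 * cos s)"
    by (simp add: abs_mult sqrt_two_plus_two_cos)
  then have "?b^2 = (\<bar>k\<bar> * sqrt (2 + 2 * cos s))^2"
    by (metis power2_abs)
  then have "?b^2 - 4 * ?a^2 = P_disc \<bar>k\<bar> s"
    using two_plus_two_cos_nonneg[of s] by (simp add: P_disc_def power_mult_distrib)
  then have CC: "2 * C = max (\<bar>k\<bar> * sqrt (2 + 2 * cos s)) (2 * \<bar>1 + 2 * cos s\<bar>) + sqrt (max 0 (P_disc \<bar>k\<bar> s))"
    unfolding C_def b by simp
  have C: "C > 0" "ln C = P_inner \<bar>k\<bar> s"
    using P_inner_arg_pos[of "\<bar>k\<bar>" s] assms unfolding CC[symmetric] P_inner_def by auto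
  have nz: "?a \<noteq> 0 \<or> ?b \<noteq> 0"
  proof (rule ccontr)
    assume "\<not> ?thesis"
    then have "C = 0" unfolding C_def by simp
    with C show False by simp
  qed
  obtain z w where zw: "cmod z \<le> 1" "cmod w \<le> 1"
    and fac: "\<And>X. cmod X = 1 \<Longrightarrow> cmod (of_real ?a * X^2 + of_real ?b * X + of_real ?a) = C * cmod (1 + z * X) * cmod (1 + w * X)"
    by (rule reciprocal_quadratic_factor[OF nz, folded C_def]) (rule that)
  let ?u = "cis (- s / 2)"
  have F: "cmod (P_poly k (cis s) (cis t)) = C * cmod (1 + (z * ?u) * cis t) * cmod (1 + (w * ?u) * cis t)" for t
    unfolding cmod_P_poly by (subst fac) (simp_all add: norm_mult mult.assoc)
  have zu: "cmod (z * ?u) \<le> 1" "cmod (w * ?u) \<le> 1" using zw by (simp_all add: norm_mult)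
  note circ_log_product[of _ _ _ "\<lambda>t. P_poly k (cis s) (cis t)", OF zu C(1) F, unfolded C(2)]
  then show "integrable circ (\<lambda>t. ln (cmod (P_poly k (cis s) (cis t))))"
    and "(\<integral>t. ln (cmod (P_poly k (cis s) (cis t))) \<partial>circ) = 2 * pi * P_inner \<bar>k\<bar> s"
    and "(\<integral>t. \<bar>ln (cmod (P_poly k (cis s) (cis t)))\<bar> \<partial>circ) \<le> 2 * pi * \<bar>P_inner \<bar>k\<bar> s\<bar> + 8 * pi * ln 2"
    by auto
qed

lemma mahler_P_poly:
  assumes "\<bar>k\<bar> \<ge> 1"
  shows "mahler_measure2 (P_poly k) = 1 / (2 * pi) * (\<integral>s. P_inner \<bar>k\<bar> s \<partial>circ)"
proof -
  have k: "k \<noteq> 0" using assms by auto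
  let ?H = "\<lambda>s t. ln (cmod (P_poly k (cis s) (cis t)))"
  have m: "(\<lambda>p. ?H (fst p) (snd p)) \<in> borel_measurable (borel \<Otimes>\<^sub>M borel)"
    unfolding P_poly_def by measurable
  have "integrable (circ \<Otimes>\<^sub>M circ) (\<lambda>p. ?H (fst p) (snd p))"
    by (rule integrable_circ_pairI[OF m, of "\<lambda>s. 2 * pi * \<bar>P_inner \<bar>k\<bar> s\<bar> + 8 * pi * ln 2"])
       (use P_poly_inner(1,3)[OF k] integrable_P_inner[OF assms] in auto)
  from circ_pair_integral_fst[OF this]
  have "(\<integral>p. ?H (fst p) (snd p) \<partial>(circ \<Otimes>\<^sub>M circ)) = 2 * pi * (\<integral>s. P_inner \<bar>k\<bar> s \<partial>circ)"
    by (simp add: P_poly_inner(2)[OF k])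
  then show ?thesis
    unfolding mahler_measure2_circ[OF m] by (simp add: power2_eq_square)
qed

text \<open>For \<open>y = x w\<close> the cubic \<open>R\<close> becomes \<open>x\<close> times a quadratic polynomial in \<open>x\<close>.\<close>
lemma cmod_R_poly:
  "cmod (R_poly k x (x * cis u)) = cmod x *
     cmod (of_real (2 * cos (3 * u / 2)) * (cis (u / 2) * x)^2 + of_real k * (cis (u / 2) * x)
       - of_real (2 * cos (u / 2)))"
proof -
  define e where "e = cis (u / 2)"
  have e: "e \<noteq> 0" "cmod e = 1" by (auto simp: e_def)
  have w: "cis u = e^2" by (simp add: e_def power2_eq_square cis_mult)
  have e3: "cis (3 * u / 2) = e^3" by (simp add: e_def power3_eq_cube cis_mult)
  have "of_real (2 * cos (3 * u / 2)) = e^3 + inverse (e^3)" "of_real (2 * cos (u / 2)) = e + inverse e"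
    using of_real_two_cos[of "3 * u / 2"] of_real_two_cos[of "u / 2"] unfolding e3 e_def by simp_all
  then have "R_poly k x (x * cis u) = x * e * (of_real (2 * cos (3 * u / 2)) * (e * x)^2 + of_real k * (e * x)
       - of_real (2 * cos (u / 2)))"
    unfolding R_poly_def w using e(1) by (simp only:) (simp add: field_simps power2_eq_square power3_eq_cube)
  then show ?thesis
    using e(2) by (simp add: norm_mult e_def)
qed

text \<open>This is where the threshold on \<open>k\<close> comes from: it forces one root inside and one outside the circle.\<close>
lemma cos_diff_bound: "\<bar>2 * cos (3 * x) - 2 * cos x\<bar> \<le> 16 / (3 * sqrt 3)"
proof -
  define y where "y = (cos x)^2"
  have y: "0 \<le> y" "y \<le> 1" by (auto simp: y_def abs_square_le_1)
  have "2 * cos (3 * x) - 2 * cos x = - 8 * cos x * (1 - y)"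
    unfolding cos_treble_cos y_def by (simp add: power2_eq_square power3_eq_cube algebra_simps)
  then have "(2 * cos (3 * x) - 2 * cos x)^2 = 64 * (y * (1 - y)^2)"
    by (simp add: power_mult_distrib y_def)
  \<comment> \<open>The maximum of y (1 - y)^2 for y between 0 and 1 is 4/27, attained at y = 1/3,
    hence the double factor.\<close>
  moreover have "4 / 27 - y * (1 - y)^2 = (1 / 3 - y)^2 * (4 / 3 - y)"
    by (simp add: power2_eq_square field_simps)
  moreover have "(1 / 3 - y)^2 * (4 / 3 - y) \<ge> 0" using y by simp
  ultimately have "(2 * cos (3 * x) - 2 * cos x)^2 \<le> 256 / 27" by linarith
  also have "256 / 27 = (16 / (3 * sqrt 3))^2" by (simp add: power_divide power_mult_distrib)
  finally show ?thesis
    using abs_le_square_iff[of "2 * cos (3 * x) - 2 * cos x" "16 / (3 * sqrt 3)"] by simp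
qed

text \<open>Places the range where Jensen's formula for \<open>R\<close> applies inside the range of
  the period identity.\<close>

lemma threshold_gt_3: "16 / (3 * sqrt 3) > 3"
proof (rule power2_less_imp_less)
  have "(16 / (3 * sqrt 3))^2 = 256 / 27" by (simp add: power_divide power_mult_distrib)
  then show "3^2 < (16 / (3 * sqrt 3))^2" by simp
qed simp

text \<open>The condition |p - q| <= |k| is equivalent to (p + q)^2 <= k^2 + 4 p q, so the roots are
  real and the factorisation has both coefficients in the closed unit disc. At equality a root lies
  on the circle, which the closed-disc form of Jensen's formula permits.\<close>

lemma R_poly_inner:
  assumes k: "\<bar>k\<bar> \<ge> 16 / (3 * sqrt 3)"
  shows "integrable circ (\<lambda>s. ln (cmod (R_poly k (cis s) (cis (s + u)))))"
    and "(\<integral>s. ln (cmod (R_poly k (cis s) (cis (s + u)))) \<partial>circ) = 2 * pi * R_inner \<bar>k\<bar> u"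
    and "(\<integral>s. \<bar>ln (cmod (R_poly k (cis s) (cis (s + u))))\<bar> \<partial>circ) \<le> 2 * pi * \<bar>R_inner \<bar>k\<bar> u\<bar> + 8 * pi * ln 2"
proof -
  define p q where "p = 2 * cos (3 * u / 2)" and "q = 2 * cos (u / 2)"
  have k3: "\<bar>k\<bar> > 3" using k threshold_gt_3 by linarith
  have pq: "\<bar>p - q\<bar> \<le> \<bar>k\<bar>"
    using cos_diff_bound[of "u / 2"] k by (simp add: p_def q_def)
  define r where "r = sqrt (k^2 + 4 * (p * q))"
  have "\<bar>p - q\<bar>^2 \<le> \<bar>k\<bar>^2" using pq by (intro power_mono) auto
  then have disc: "(p + q)^2 \<le> k^2 + 4 * (p * q)"
    by (simp add: power2_eq_square algebra_simps)
  then have r: "\<bar>p + q\<bar> \<le> r" "r^2 = k^2 + 4 * (p * q)"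
    unfolding r_def using real_sqrt_le_mono[OF disc] order_trans[OF zero_le_power2 disc] by auto
  define m where "m = sgn k * ((\<bar>k\<bar> + r) / 2)"
  have am: "\<bar>m\<bar> = (\<bar>k\<bar> + r) / 2" using k3 r(1) by (auto simp: m_def abs_mult)
  have r0: "r \<ge> 0" using order_trans[OF abs_ge_zero r(1)] .
  then have "\<bar>m\<bar> > 0" unfolding am using k3 by simp
  then have m: "m \<noteq> 0" by simp
  \<comment> \<open>Here |m| is at least (|p - q| + |p + q|) / 2, which is the larger of |p| and
    |q|.\<close>
  have le: "\<bar>p\<bar> \<le> \<bar>m\<bar>" "\<bar>q\<bar> \<le> \<bar>m\<bar>"
    unfolding am using pq[unfolded abs_le_iff] r(1)[unfolded abs_le_iff] by (auto intro!: abs_leI)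
  have mm: "m^2 = k * m + p * q"
  proof -
    have "m^2 = ((\<bar>k\<bar> + r) / 2)^2" using am by (metis power2_abs)
    moreover have "k * m = \<bar>k\<bar> * ((\<bar>k\<bar> + r) / 2)" by (simp add: m_def abs_sgn)
    moreover have "\<bar>k\<bar>^2 = k^2" by simp
    ultimately show ?thesis using r(2) by (simp add: power2_eq_square field_simps)
  qed
  have "4 * (p * q) = 16 * (cos u)^2 + 8 * cos u - 8"
  proof -
    define d where "d = cos (u / 2)"
    have 1: "cos u = 2 * d^2 - 1" using cos_double_cos[of "u / 2"] by (simp add: d_def)
    have 2: "cos (3 * u / 2) = 4 * d^3 - 3 * d" using cos_treble_cos[of "u / 2"] by (simp add: d_def)
    show ?thesis
      unfolding p_def q_def d_def[symmetric] 1 2 by (simp add: power2_eq_square power3_eq_cube algebra_simps)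
  qed
  then have "k^2 + 4 * (p * q) = 2^2 * R_disc \<bar>k\<bar> u" by (simp add: R_disc_def)
  then have "r = 2 * sqrt (R_disc \<bar>k\<bar> u)" unfolding r_def by (simp only: real_sqrt_mult) simp
  then have lnm: "ln \<bar>m\<bar> = R_inner \<bar>k\<bar> u" unfolding am R_inner_def by (simp add: add_divide_distrib)
  let ?e = "cis (u / 2)"
  have F: "cmod (R_poly k (cis s) (cis (s + u))) =
      \<bar>m\<bar> * cmod (1 + (of_real (p / m) * ?e) * cis s) * cmod (1 + (of_real (- q / m) * ?e) * cis s)" for s
  proof -
    have X: "cmod (?e * cis s) = 1" by (simp add: norm_mult)
    have "cis (s + u) = cis s * cis u" by (simp add: cis_mult)
    then show ?thesis
      using cmod_R_poly[of k "cis s" u] quadratic_factor_real_roots[OF m mm X]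
      unfolding p_def[symmetric] q_def[symmetric] by (simp add: mult.assoc)
  qed
  have z: "cmod (of_real (p / m) * ?e) \<le> 1" "cmod (of_real (- q / m) * ?e) \<le> 1"
    using le m by (simp_all add: norm_mult norm_divide)
  note circ_log_product[of _ _ _ "\<lambda>s. R_poly k (cis s) (cis (s + u))", OF z _ F, unfolded lnm]
  then show "integrable circ (\<lambda>s. ln (cmod (R_poly k (cis s) (cis (s + u)))))"
    and "(\<integral>s. ln (cmod (R_poly k (cis s) (cis (s + u)))) \<partial>circ) = 2 * pi * R_inner \<bar>k\<bar> u"
    and "(\<integral>s. \<bar>ln (cmod (R_poly k (cis s) (cis (s + u))))\<bar> \<partial>circ) \<le> 2 * pi * \<bar>R_inner \<bar>k\<bar> u\<bar> + 8 * pi * ln 2"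
    using m by auto
qed

lemma mahler_R_poly:
  assumes k: "\<bar>k\<bar> \<ge> 16 / (3 * sqrt 3)"
  shows "mahler_measure2 (R_poly k) = 1 / (2 * pi) * (\<integral>u. R_inner \<bar>k\<bar> u \<partial>circ)"
proof -
  have k3: "\<bar>k\<bar> > 3" using k threshold_gt_3 by linarith
  let ?H = "\<lambda>s t. ln (cmod (R_poly k (cis s) (cis t)))"
  have m: "(\<lambda>p. ?H (fst p) (snd p)) \<in> borel_measurable (borel \<Otimes>\<^sub>M borel)"
    unfolding R_poly_def by measurable
  have m': "(\<lambda>p. ?H (snd p) (snd p + fst p)) \<in> borel_measurable (borel \<Otimes>\<^sub>M borel)"
    unfolding R_poly_def by measurable
  have int: "integrable (circ \<Otimes>\<^sub>M circ) (\<lambda>p. ?H (snd p) (snd p + fst p))"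
    by (rule integrable_circ_pairI[of "\<lambda>u s. ?H s (s + u)", OF m', of "\<lambda>u. 2 * pi * \<bar>R_inner \<bar>k\<bar> u\<bar> + 8 * pi * ln 2"])
       (use R_poly_inner(1,3)[OF k] integrable_R_inner[OF k3] in auto)
  have "(\<integral>p. ?H (fst p) (snd p) \<partial>(circ \<Otimes>\<^sub>M circ)) = 2 * pi * (\<integral>u. R_inner \<bar>k\<bar> u \<partial>circ)"
    using circ_pair_shear[of ?H, OF m _ int] by (simp add: cis_2pi_periodic R_poly_inner(2)[OF k])
  then show ?thesis
    unfolding mahler_measure2_circ[OF m] by (simp add: power2_eq_square)
qed

theorem theorem2:
  fixes k :: real
  assumes "\<bar>k\<bar> \<ge> 16 / (3 * sqrt 3)"
  shows "mahler_measure2 (P_poly k) = mahler_measure2 (R_poly k)"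
proof -
  have "\<bar>k\<bar> > 3" using assms threshold_gt_3 by linarith
  then show ?thesis
    using mahler_P_poly[of k] mahler_R_poly[OF assms] integral_P_inner_eq_R_inner[of "\<bar>k\<bar>"] by simp
qed

end
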